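(* The following subalgebras of the algebra $Q_n$ coincide: (i) the intersection $\bigcap_{\tau\in S_n}Q_{n,\tau}$ of all subalgebras $Q_{n,\tau}$; (ii) for any permutation $\sigma\in S_n$, the subalgebra of all $S_n$-invariant elements of $Q_{n,\sigma}$ (that is, all $w\in Q_{n,\sigma}$ with $\tau(w)=w$ for every $\tau\in S_n$); (iii) the subalgebra generated by the coefficients of $P(t)$.
   Context: Let $k$ be a field and $n\ge 1$. $Q_n$ is the associative unital $k$-algebra with generators $z_{A,i}$, for $A\subseteq\{1,\dots,n\}$ and $i\in\{1,\dots,n\}\setminus A$, and defining relations $$z_{A\cup\{i\},j}+z_{A,i}=z_{A\cup\{j\},i}+z_{A,j},\qquad z_{A\cup\{i\},j}\,z_{A,i}=z_{A\cup\{j\},i}\,z_{A,j}$$ for all $A$ and all distinct $i,j\notin A$. Subalgebras are unital $k$-subalgebras. The symmetric group $S_n$ acts on $Q_n$ by algebra automorphisms with $\sigma(z_{A,i})=z_{\sigma(A),\sigma(i)}$. For $A=\{c_1,\dots,c_u\}$ put $r(A)=z_{\emptyset,c_1}+z_{\{c_1\},c_2}+\dots+z_{\{c_1,\dots,c_{u-1}\},c_u}$, which does not depend on the ordering of $A$. For $\sigma\in S_n$, $Q_{n,\sigma}$ is the subalgebra of $Q_n$ generated by $r(\{\sigma(1),\dots,\sigma(m)\})$, $m=1,\dots,n$. For $\sigma\in S_n$ put $y_{m,\sigma}=z_{\{\sigma(1),\dots,\sigma(m-1)\},\sigma(m)}$, $m=1,\dots,n$. With $t$ a central variable, the polynomial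 $$P(t)=(t-y_{n,\sigma})(t-y_{n-1,\sigma})\cdots(t-y_{1,\sigma})\in Q_n[t]$$ does not depend on $\sigma$. *)

theory Defs
  imports
    "HOL-Library.Poly_Mapping"
    "HOL-Combinatorics.Permutations"
    "HOL-Algebra.QuotRing"
    "HOL-Algebra.Subrings"
    "HOL-Algebra.UnivPoly"
begin

section \<open>Free algebras\<close>

text \<open>The free monoid is a type of its own because \<^typ>\<open>'a list\<close> is not an instance
  of \<^class>\<open>monoid_add\<close>; with it, the monoid algebra
  \<open>'a free_mon \<Rightarrow>\<^sub>0 'k\<close> is the free unital associative algebra on
  \<^typ>\<open>'a\<close>, multiplication being concatenation of words.\<close>

datatype 'a free_mon = Mon (letters: "'a list")

instantiation free_mon :: (type) monoid_add
begin
definition zero_free_mon :: "'a free_mon" where "0 = Mon []"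
definition plus_free_mon :: "'a free_mon \<Rightarrow> 'a free_mon \<Rightarrow> 'a free_mon"
  where "u + v = Mon (letters u @ letters v)"
instance by standard (simp_all add: zero_free_mon_def plus_free_mon_def)
end

definition free_algebra :: "'a set \<Rightarrow> ('a free_mon \<Rightarrow>\<^sub>0 'k::field) ring" where
  "free_algebra G =
     \<lparr>carrier = {p. \<forall>w \<in> Poly_Mapping.keys p. set (letters w) \<subseteq> G}, mult = (*), one = 1, zero = 0, add = (+)\<rparr>"

definition const :: "'k::field \<Rightarrow> ('a free_mon \<Rightarrow>\<^sub>0 'k)" where
  "const c = Poly_Mapping.single 0 c"

definition var :: "'a \<Rightarrow> ('a free_mon \<Rightarrow>\<^sub>0 'k::field)" where
  "var g = Poly_Mapping.single (Mon [g]) 1"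

definition map_mon :: "('a \<Rightarrow> 'b) \<Rightarrow> 'a free_mon \<Rightarrow> 'b free_mon" where
  "map_mon f w = Mon (map f (letters w))"

definition free_map :: "('a \<Rightarrow> 'b) \<Rightarrow> ('a free_mon \<Rightarrow>\<^sub>0 'k::field) \<Rightarrow> ('b free_mon \<Rightarrow>\<^sub>0 'k)" where
  "free_map f p = (\<Sum>w \<in> Poly_Mapping.keys p. Poly_Mapping.single (map_mon f w) (Poly_Mapping.lookup p w))"


section \<open>The algebra \<open>Q\<^sub>n\<close>\<close>

type_synonym gen = "nat set \<times> nat"
type_synonym 'k free_elt = "gen free_mon \<Rightarrow>\<^sub>0 'k"
type_synonym 'k Q_elt = "'k free_elt set"

definition gens :: "nat \<Rightarrow> gen set" where
  "gens n = {(A, i). A \<subseteq> {1..n} \<and> i \<in> {1..n} - A}"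

definition rels :: "nat \<Rightarrow> 'k::field free_elt set" where
  "rels n =
     {(var (insert i A, j) + var (A, i)) - (var (insert j A, i) + var (A, j)) | A i j.
        A \<subseteq> {1..n} \<and> i \<in> {1..n} - A \<and> j \<in> {1..n} - A \<and> i \<noteq> j}
     \<union> {var (insert i A, j) * var (A, i) - var (insert j A, i) * var (A, j) | A i j.
        A \<subseteq> {1..n} \<and> i \<in> {1..n} - A \<and> j \<in> {1..n} - A \<and> i \<noteq> j}"

definition rel_ideal :: "nat \<Rightarrow> 'k::field free_elt set" where
  "rel_ideal n = genideal (free_algebra (gens n)) (rels n)"

definition Q :: "nat \<Rightarrow> 'k::field Q_elt ring" where
  "Q n = free_algebra (gens n) Quot rel_ideal n"

definition quot :: "nat \<Rightarrow> 'k::field free_elt \<Rightarrow> 'k Q_elt" where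
  "quot n p = rel_ideal n +>\<^bsub>free_algebra (gens n)\<^esub> p"

definition z :: "nat \<Rightarrow> nat set \<Rightarrow> nat \<Rightarrow> 'k::field Q_elt" where
  "z n A i = quot n (var (A, i))"

text \<open>The locale \<^locale>\<open>subring\<close> includes closure under the unit.  The library's
  \<open>Embedded_Algebras.subalgebra\<close> is not used: it does not require closure under products.\<close>

definition unital_subalgebra :: "nat \<Rightarrow> 'k::field Q_elt set \<Rightarrow> bool" where
  "unital_subalgebra n V \<longleftrightarrow> subring V (Q n) \<and> (\<forall>c. quot n (const c) \<in> V)"

definition alg_gen :: "nat \<Rightarrow> 'k::field Q_elt set \<Rightarrow> 'k Q_elt set" where
  "alg_gen n S = unital_subalgebra n hull S"

text \<open>The action of a permutation of \<open>{1..n}\<close>: the image of a coset under the automorphism of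
  the free algebra that permutes the generators is again a coset, since that automorphism
  preserves the ideal of relations (see \<open>act_quot\<close> below).\<close>

definition act :: "(nat \<Rightarrow> nat) \<Rightarrow> 'k::field Q_elt \<Rightarrow> 'k Q_elt" where
  "act \<sigma> X = free_map (map_prod (image \<sigma>) \<sigma>) ` X"


section \<open>The subalgebras \<open>Q\<^sub>n\<^sub>,\<^sub>\<sigma>\<close> and the polynomial \<open>P(t)\<close>\<close>

definition r_list :: "nat \<Rightarrow> nat list \<Rightarrow> 'k::field Q_elt" where
  "r_list n cs = (\<Oplus>\<^bsub>Q n\<^esub>i\<in>{..<length cs}. z n (set (take i cs)) (cs ! i))"

text \<open>The value of \<open>r\<close> does not depend on the ordering of \<open>A\<close>; the increasing one is used here
  (see \<open>r_eq_r_list\<close> below).\<close>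

definition r :: "nat \<Rightarrow> nat set \<Rightarrow> 'k::field Q_elt" where
  "r n A = r_list n (sorted_list_of_set A)"

definition Q_perm :: "nat \<Rightarrow> (nat \<Rightarrow> nat) \<Rightarrow> 'k::field Q_elt set" where
  "Q_perm n \<sigma> = alg_gen n {r n (\<sigma> ` {1..m}) | m. m \<in> {1..n}}"

definition y :: "nat \<Rightarrow> (nat \<Rightarrow> nat) \<Rightarrow> nat \<Rightarrow> 'k::field Q_elt" where
  "y n \<sigma> m = z n (\<sigma> ` {1..<m}) (\<sigma> m)"

text \<open>In \<^const>\<open>UP\<close> the variable commutes with all coefficients, also over a
  noncommutative ring.  The product below is independent of the permutation (see \<open>P_indep\<close>).\<close>

definition lin_factor :: "nat \<Rightarrow> 'k::field Q_elt \<Rightarrow> nat \<Rightarrow> 'k Q_elt" where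
  "lin_factor n a = monom (UP (Q n)) \<one>\<^bsub>Q n\<^esub> 1 \<ominus>\<^bsub>UP (Q n)\<^esub> monom (UP (Q n)) a 0"

definition P :: "nat \<Rightarrow> (nat \<Rightarrow> nat) \<Rightarrow> nat \<Rightarrow> 'k::field Q_elt" where
  "P n \<sigma> = foldr (\<lambda>m p. lin_factor n (y n \<sigma> m) \<otimes>\<^bsub>UP (Q n)\<^esub> p) (rev [1..<Suc n]) \<one>\<^bsub>UP (Q n)\<^esub>"

definition P_coeffs :: "nat \<Rightarrow> (nat \<Rightarrow> nat) \<Rightarrow> 'k::field Q_elt set" where
  "P_coeffs n \<sigma> = range (coeff (UP (Q n)) (P n \<sigma>))"

definition S_invariants :: "nat \<Rightarrow> 'k::field Q_elt set \<Rightarrow> 'k Q_elt set" where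
  "S_invariants n V = {w \<in> V. \<forall>\<tau>. \<tau> permutes {1..n} \<longrightarrow> act \<tau> w = w}"


section \<open>The definitions are as intended\<close>

lemma ring_free_algebra: "ring (free_algebra G :: ('a free_mon \<Rightarrow>\<^sub>0 'k::field) ring)"
proof (rule ringI)
  let ?F = "free_algebra G :: ('a free_mon \<Rightarrow>\<^sub>0 'k) ring"
  have neg: "\<exists>q\<in>carrier ?F. q + p = 0" if "p \<in> carrier ?F" for p
    using that by (intro bexI[of _ "- p"]) (auto simp: free_algebra_def)
  show "abelian_group ?F"
    using neg
    by (intro abelian_groupI) (auto simp: free_algebra_def ac_simps dest!: subsetD[OF keys_add])
  have mult: "p * q \<in> carrier ?F" if "p \<in> carrier ?F" "q \<in> carrier ?F" for p q
  proof -
    have "set (letters w) \<subseteq> G" if w: "w \<in> Poly_Mapping.keys (p * q)" for w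
    proof -
      obtain u v where "w = u + v" "u \<in> Poly_Mapping.keys p" "v \<in> Poly_Mapping.keys q"
        using subsetD[OF keys_mult w] by auto
      thus ?thesis
        using \<open>p \<in> carrier ?F\<close> \<open>q \<in> carrier ?F\<close>
        by (simp add: free_algebra_def plus_free_mon_def)
    qed
    thus ?thesis by (simp add: free_algebra_def)
  qed
  show "Group.monoid ?F"
  proof (rule monoidI)
    show "\<one>\<^bsub>?F\<^esub> \<in> carrier ?F"
      by (simp add: free_algebra_def zero_free_mon_def)
    show "p \<otimes>\<^bsub>?F\<^esub> q \<in> carrier ?F" if "p \<in> carrier ?F" "q \<in> carrier ?F" for p q
      using mult[OF that] by (simp add: free_algebra_def)
  qed (simp_all add: free_algebra_def mult.assoc)
qed (simp_all add: free_algebra_def distrib_left distrib_right)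

lemma a_minus_free_algebra:
  assumes "p \<in> carrier (free_algebra G)" "q \<in> carrier (free_algebra G)"
  shows "p \<ominus>\<^bsub>free_algebra G\<^esub> q = p - q"
proof -
  interpret ring "free_algebra G" by (rule ring_free_algebra)
  have q: "- q \<in> carrier (free_algebra G)" using assms by (auto simp: free_algebra_def)
  have "\<ominus>\<^bsub>free_algebra G\<^esub> q = - q"
    by (rule minus_equality) (use assms q in \<open>auto simp: free_algebra_def\<close>)
  thus ?thesis by (simp add: a_minus_def) (simp add: free_algebra_def)
qed

lemma const_closed: "const c \<in> carrier (free_algebra G)"
  by (auto simp: const_def free_algebra_def zero_free_mon_def)

lemma var_closed: "g \<in> G \<Longrightarrow> var g \<in> carrier (free_algebra G)"
  by (auto simp: var_def free_algebra_def)

lemma free_closed: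
  assumes "p \<in> carrier (free_algebra G)" "q \<in> carrier (free_algebra G)"
  shows "p + q \<in> carrier (free_algebra G)" "p * q \<in> carrier (free_algebra G)"
    "p - q \<in> carrier (free_algebra G)"
proof -
  interpret ring "free_algebra G" by (rule ring_free_algebra)
  show "p + q \<in> carrier (free_algebra G)" "p * q \<in> carrier (free_algebra G)"
    using a_closed[OF assms] m_closed[OF assms] by (simp_all add: free_algebra_def)
  show "p - q \<in> carrier (free_algebra G)"
    using minus_closed[OF assms] a_minus_free_algebra[OF assms] by simp
qed

lemma gens_insert:
  assumes "A \<subseteq> {1..n}" "i \<in> {1..n} - A" "j \<in> {1..n} - A" "i \<noteq> j"
  shows "(A, i) \<in> gens n" "(insert i A, j) \<in> gens n"
  using assms by (auto simp: gens_def)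

lemma rels_closed: "rels n \<subseteq> (carrier (free_algebra (gens n)) :: 'k::field free_elt set)"
proof
  have mem: "var (insert i A, j) + var (A, i) - (var (insert j A, i) + var (A, j))
        \<in> (carrier (free_algebra (gens n)) :: 'k free_elt set)"
      "var (insert i A, j) * var (A, i) - var (insert j A, i) * var (A, j)
        \<in> (carrier (free_algebra (gens n)) :: 'k free_elt set)"
    if *: "A \<subseteq> {1..n}" "i \<in> {1..n} - A" "j \<in> {1..n} - A" "i \<noteq> j" for A i j
    using gens_insert[OF *] gens_insert[OF *(1,3,2) not_sym[OF *(4)]]
    by (simp_all add: free_closed var_closed)
  fix p :: "'k free_elt"
  assume "p \<in> rels n"
  then consider
    A i j where "A \<subseteq> {1..n}" "i \<in> {1..n} - A" "j \<in> {1..n} - A" "i \<noteq> j"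
      "p = (var (insert i A, j) + var (A, i)) - (var (insert j A, i) + var (A, j))"
  | A i j where "A \<subseteq> {1..n}" "i \<in> {1..n} - A" "j \<in> {1..n} - A" "i \<noteq> j"
      "p = var (insert i A, j) * var (A, i) - var (insert j A, i) * var (A, j)"
    unfolding rels_def Un_iff mem_Collect_eq by metis
  thus "p \<in> carrier (free_algebra (gens n))"
  proof cases
    case (1 A i j)
    show ?thesis unfolding 1(5) by (rule mem(1)[OF 1(1-4)])
  next
    case (2 A i j)
    show ?thesis unfolding 2(5) by (rule mem(2)[OF 2(1-4)])
  qed
qed

lemma rel_ideal: "ideal (rel_ideal n) (free_algebra (gens n))"
  unfolding rel_ideal_def by (rule ring.genideal_ideal[OF ring_free_algebra rels_closed])

lemma ring_Q: "ring (Q n)"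
  unfolding Q_def by (rule ideal.quotient_is_ring[OF rel_ideal])

lemma quot_hom: "quot n \<in> ring_hom (free_algebra (gens n)) (Q n)"
  unfolding Q_def quot_def[abs_def] by (rule ideal.rcos_ring_hom[OF rel_ideal])

lemma quot_closed: "p \<in> carrier (free_algebra (gens n)) \<Longrightarrow> quot n p \<in> carrier (Q n)"
  by (rule ring_hom_memE(1)[OF quot_hom])

lemma quot_add:
  "p \<in> carrier (free_algebra (gens n)) \<Longrightarrow> q \<in> carrier (free_algebra (gens n))
    \<Longrightarrow> quot n (p + q) = quot n p \<oplus>\<^bsub>Q n\<^esub> quot n q"
  using ring_hom_memE(3)[OF quot_hom] by (simp add: free_algebra_def)

lemma quot_mult:
  "p \<in> carrier (free_algebra (gens n)) \<Longrightarrow> q \<in> carrier (free_algebra (gens n))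
    \<Longrightarrow> quot n (p * q) = quot n p \<otimes>\<^bsub>Q n\<^esub> quot n q"
  using ring_hom_memE(2)[OF quot_hom] by (simp add: free_algebra_def)

lemma quot_eqI:
  assumes "p \<in> carrier (free_algebra (gens n))" "q \<in> carrier (free_algebra (gens n))"
    and "p - q \<in> rel_ideal n"
  shows "quot n p = quot n q"
  using ring.quotient_eq_iff_same_a_r_cos[OF ring_free_algebra rel_ideal assms(1,2)] assms(3)
  by (simp add: quot_def a_minus_free_algebra assms)

lemma z_closed: "A \<subseteq> {1..n} \<Longrightarrow> i \<in> {1..n} - A \<Longrightarrow> z n A i \<in> carrier (Q n)"
  unfolding z_def by (intro quot_closed var_closed) (auto simp: gens_def)

lemma rels_rel_ideal: "rels n \<subseteq> rel_ideal n"
  unfolding rel_ideal_def by (rule ring.genideal_self[OF ring_free_algebra rels_closed])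

lemma z_add:
  assumes "A \<subseteq> {1..n}" "i \<in> {1..n} - A" "j \<in> {1..n} - A" "i \<noteq> j"
  shows "z n (insert i A) j \<oplus>\<^bsub>Q n\<^esub> z n A i
    = (z n (insert j A) i \<oplus>\<^bsub>Q n\<^esub> z n A j :: 'k::field Q_elt)"
proof -
  note g = var_closed[OF gens_insert(1)[OF assms]] var_closed[OF gens_insert(2)[OF assms]]
    var_closed[OF gens_insert(1)[OF assms(1,3,2) not_sym[OF assms(4)]]]
    var_closed[OF gens_insert(2)[OF assms(1,3,2) not_sym[OF assms(4)]]]
  have "(var (insert i A, j) + var (A, i)) - (var (insert j A, i) + var (A, j))
      \<in> (rels n :: 'k free_elt set)"
    using assms unfolding rels_def by blast
  hence "quot n (var (insert i A, j) + var (A, i))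
      = (quot n (var (insert j A, i) + var (A, j)) :: 'k Q_elt)"
    by (intro quot_eqI free_closed g subsetD[OF rels_rel_ideal])
  thus ?thesis by (simp add: z_def quot_add g)
qed

lemma z_mult:
  assumes "A \<subseteq> {1..n}" "i \<in> {1..n} - A" "j \<in> {1..n} - A" "i \<noteq> j"
  shows "z n (insert i A) j \<otimes>\<^bsub>Q n\<^esub> z n A i
    = (z n (insert j A) i \<otimes>\<^bsub>Q n\<^esub> z n A j :: 'k::field Q_elt)"
proof -
  note g = var_closed[OF gens_insert(1)[OF assms]] var_closed[OF gens_insert(2)[OF assms]]
    var_closed[OF gens_insert(1)[OF assms(1,3,2) not_sym[OF assms(4)]]]
    var_closed[OF gens_insert(2)[OF assms(1,3,2) not_sym[OF assms(4)]]]
  have "(var (insert i A, j) * var (A, i)) - (var (insert j A, i) * var (A, j))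
      \<in> (rels n :: 'k free_elt set)"
    using assms unfolding rels_def by blast
  hence "quot n (var (insert i A, j) * var (A, i))
      = (quot n (var (insert j A, i) * var (A, j)) :: 'k Q_elt)"
    by (intro quot_eqI free_closed g subsetD[OF rels_rel_ideal])
  thus ?thesis by (simp add: z_def quot_mult g)
qed

lemma free_map_sum:
  assumes "finite S" "Poly_Mapping.keys p \<subseteq> S"
  shows "free_map f p = (\<Sum>w\<in>S. Poly_Mapping.single (map_mon f w) (Poly_Mapping.lookup p w))"
  unfolding free_map_def by (rule sum.mono_neutral_left) (use assms in \<open>auto simp: in_keys_iff\<close>)

lemma free_map_single: "free_map f (Poly_Mapping.single w c) = Poly_Mapping.single (map_mon f w) c"
  by (simp add: free_map_def)

lemma free_map_0: "free_map f 0 = 0"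
  by (simp add: free_map_def)

lemma free_map_add: "free_map f (p + q) = free_map f p + free_map f q"
proof -
  let ?S = "Poly_Mapping.keys p \<union> Poly_Mapping.keys q"
  have "Poly_Mapping.keys (p + q) \<subseteq> ?S" by (rule keys_add)
  thus ?thesis
    by (simp add: free_map_sum[of ?S] lookup_add single_add sum.distrib)
qed

lemma free_map_uminus: "free_map f (- p) = - free_map f p"
  using free_map_add[of f p "- p"] by (simp add: free_map_0 eq_neg_iff_add_eq_0 add.commute)

lemma free_map_diff: "free_map f (p - q) = free_map f p - free_map f q"
  using free_map_add[of f p "- q"] by (simp add: free_map_uminus)

lemma free_map_sum': "free_map f (\<Sum>i\<in>I. p i) = (\<Sum>i\<in>I. free_map f (p i))"
  by (induction I rule: infinite_finite_induct) (simp_all add: free_map_0 free_map_add)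

lemma sum_single_keys: "(\<Sum>w\<in>Poly_Mapping.keys p. Poly_Mapping.single w (Poly_Mapping.lookup p w)) = p"
  by (rule poly_mapping_eqI)
    (auto simp: lookup_sum lookup_single when_def in_keys_iff)

lemma map_mon_add: "map_mon f (u + v) = map_mon f u + map_mon f v"
  by (simp add: map_mon_def plus_free_mon_def)

lemma free_map_mult: "free_map f (p * q) = free_map f p * free_map f q"
proof -
  let ?s = "\<lambda>p. \<Sum>w\<in>Poly_Mapping.keys p. Poly_Mapping.single w (Poly_Mapping.lookup p w)"
  have "free_map f (?s p * ?s q) = free_map f (?s p) * free_map f (?s q)"
    by (simp add: sum_product free_map_sum' mult_single free_map_single map_mon_add)
  thus ?thesis by (simp add: sum_single_keys)
qed

lemma free_map_const: "free_map f (const c) = const c"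
  by (simp add: const_def free_map_single map_mon_def zero_free_mon_def)

lemma free_map_var: "free_map f (var g) = var (f g)"
  by (simp add: var_def free_map_single map_mon_def)

lemma free_map_comp: "free_map f (free_map g p) = free_map (f \<circ> g) p"
  by (simp add: free_map_def[of g] free_map_sum' free_map_single free_map_def[of "f \<circ> g"]
      map_mon_def)

lemma free_map_id: "free_map (\<lambda>x. x) p = p"
  by (simp add: free_map_def map_mon_def sum_single_keys)

lemma free_map_closed:
  assumes "p \<in> carrier (free_algebra G)" "f ` G \<subseteq> H"
  shows "free_map f p \<in> carrier (free_algebra H)"
proof -
  have "Poly_Mapping.keys (free_map f p) \<subseteq> (\<Union>w\<in>Poly_Mapping.keys p. {map_mon f w})"
    unfolding free_map_def
    by (rule order.trans[OF keys_sum]) (auto simp: in_keys_iff)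
  thus ?thesis using assms by (fastforce simp: free_algebra_def map_mon_def)
qed

abbreviation gen_map :: "(nat \<Rightarrow> nat) \<Rightarrow> gen \<Rightarrow> gen" where
  "gen_map \<sigma> \<equiv> map_prod (image \<sigma>) \<sigma>"

lemma gen_map_gens:
  assumes "\<sigma> permutes {1..n}"
  shows "gen_map \<sigma> ` gens n \<subseteq> gens n"
proof -
  have *: "\<sigma> ` A \<subseteq> {1..n} \<and> \<sigma> i \<in> {1..n} - \<sigma> ` A" if "A \<subseteq> {1..n}" "i \<in> {1..n} - A" for A i
    using that permutes_image[OF assms] permutes_inj[OF assms] by (auto dest: injD)
  show ?thesis
  proof (rule image_subsetI)
    fix g assume "g \<in> gens n"
    then obtain A i where "g = (A, i)" "A \<subseteq> {1..n}" "i \<in> {1..n} - A"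
      unfolding gens_def by blast
    thus "gen_map \<sigma> g \<in> gens n" using *[of A i] by (simp add: gens_def)
  qed
qed

lemma free_map_rels:
  assumes "\<sigma> permutes {1..n}" "p \<in> rels n"
  shows "free_map (gen_map \<sigma>) p \<in> rels n"
proof -
  have *: "\<sigma> ` A \<subseteq> {1..n} \<and> \<sigma> i \<in> {1..n} - \<sigma> ` A \<and> \<sigma> j \<in> {1..n} - \<sigma> ` A \<and> \<sigma> i \<noteq> \<sigma> j"
    if "A \<subseteq> {1..n} \<and> i \<in> {1..n} - A \<and> j \<in> {1..n} - A \<and> i \<noteq> j" for A i j
    using that permutes_image[OF assms(1)] permutes_inj[OF assms(1)] by (auto dest: injD)
  from assms(2) show ?thesis
    unfolding rels_def
  proof (elim UnE, goal_cases)
    case 1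
    then obtain A i j where "A \<subseteq> {1..n} \<and> i \<in> {1..n} - A \<and> j \<in> {1..n} - A \<and> i \<noteq> j"
      "p = (var (insert i A, j) + var (A, i)) - (var (insert j A, i) + var (A, j))" by blast
    thus ?case using *[of A i j]
      by (intro UnI1 CollectI exI[of _ "\<sigma> ` A"] exI[of _ "\<sigma> i"] exI[of _ "\<sigma> j"])
        (simp add: free_map_diff free_map_add free_map_var)
  next
    case 2
    then obtain A i j where "A \<subseteq> {1..n} \<and> i \<in> {1..n} - A \<and> j \<in> {1..n} - A \<and> i \<noteq> j"
      "p = var (insert i A, j) * var (A, i) - var (insert j A, i) * var (A, j)" by blast
    thus ?case using *[of A i j]
      by (intro UnI2 CollectI exI[of _ "\<sigma> ` A"] exI[of _ "\<sigma> i"] exI[of _ "\<sigma> j"])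
        (simp add: free_map_diff free_map_mult free_map_var)
  qed
qed

lemma free_map_rel_ideal:
  assumes "\<sigma> permutes {1..n}" "p \<in> rel_ideal n"
  shows "free_map (gen_map \<sigma>) p \<in> rel_ideal n"
proof -
  let ?F = "free_algebra (gens n)" and ?h = "free_map (gen_map \<sigma>)"
  have "?h \<in> ring_hom ?F ?F"
    using free_map_closed[OF _ gen_map_gens[OF assms(1)]] free_map_const[of _ 1]
    by (intro ring_hom_memI)
      (simp_all add: free_algebra_def free_map_mult free_map_add const_def)
  then interpret ring_hom_ring ?F ?F ?h
    by (intro ring_hom_ringI2 ring_free_algebra)
  have "ideal {p \<in> carrier ?F. ?h p \<in> rel_ideal n} ?F"
    by (rule ideal_vimage[OF rel_ideal])
  moreover have "rels n \<subseteq> {p \<in> carrier ?F. ?h p \<in> rel_ideal n}"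
    using rels_closed rels_rel_ideal free_map_rels[OF assms(1)] by blast
  ultimately have "rel_ideal n \<subseteq> {p \<in> carrier ?F. ?h p \<in> rel_ideal n}"
    unfolding rel_ideal_def[of n] by (intro R.genideal_minimal) (simp_all add: rel_ideal_def)
  thus ?thesis using assms(2) by blast
qed

lemma quot_eq_image: "quot n p = (\<lambda>q. q + p) ` rel_ideal n"
  by (auto simp: quot_def a_r_coset_def' free_algebra_def)

lemma free_map_rel_ideal_eq:
  assumes "\<sigma> permutes {1..n}"
  shows "free_map (gen_map \<sigma>) ` rel_ideal n = (rel_ideal n :: 'k::field free_elt set)"
proof
  show "free_map (gen_map \<sigma>) ` rel_ideal n \<subseteq> (rel_ideal n :: 'k free_elt set)"
    using free_map_rel_ideal[OF assms] by blast
  have inv: "gen_map \<sigma> \<circ> gen_map (inv_into UNIV \<sigma>) = (\<lambda>x. x)"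
    using permutes_inverses[OF assms] by (auto simp: fun_eq_iff image_image)
  show "(rel_ideal n :: 'k free_elt set) \<subseteq> free_map (gen_map \<sigma>) ` rel_ideal n"
  proof
    fix p :: "'k free_elt" assume "p \<in> rel_ideal n"
    hence "free_map (gen_map (inv_into UNIV \<sigma>)) p \<in> rel_ideal n"
      by (rule free_map_rel_ideal[OF permutes_inv[OF assms]])
    moreover have "free_map (gen_map \<sigma>) (free_map (gen_map (inv_into UNIV \<sigma>)) p) = p"
      by (simp add: free_map_comp inv free_map_id)
    ultimately show "p \<in> free_map (gen_map \<sigma>) ` rel_ideal n" by (metis imageI)
  qed
qed

lemma act_quot:
  assumes "\<sigma> permutes {1..n}"
  shows "act \<sigma> (quot n p) = quot n (free_map (gen_map \<sigma>) p)"
proof -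
  have "act \<sigma> (quot n p)
      = (\<lambda>q. q + free_map (gen_map \<sigma>) p) ` free_map (gen_map \<sigma>) ` rel_ideal n"
    by (simp add: act_def quot_eq_image image_image free_map_add)
  thus ?thesis by (simp add: quot_eq_image free_map_rel_ideal_eq[OF assms])
qed

lemma act_z: "\<sigma> permutes {1..n} \<Longrightarrow> act \<sigma> (z n A i) = z n (\<sigma> ` A) (\<sigma> i)"
  by (simp add: z_def act_quot free_map_var)

lemma act_const: "\<sigma> permutes {1..n} \<Longrightarrow> act \<sigma> (quot n (const c)) = quot n (const c)"
  by (simp add: act_quot free_map_const)

lemma Q_cases:
  assumes "X \<in> carrier (Q n)"
  obtains p where "p \<in> carrier (free_algebra (gens n))" "X = quot n p"
  using assms by (auto simp: Q_def FactRing_def A_RCOSETS_def' quot_def)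

lemma act_hom:
  assumes "\<sigma> permutes {1..n}"
  shows "act \<sigma> \<in> ring_hom (Q n :: 'k::field Q_elt ring) (Q n)"
proof (rule ring_hom_memI)
  note cl = free_map_closed[OF _ gen_map_gens[OF assms]]
  fix X Y :: "'k Q_elt" assume "X \<in> carrier (Q n)" "Y \<in> carrier (Q n)"
  then obtain p q where pq: "p \<in> carrier (free_algebra (gens n))" "X = quot n p"
    "q \<in> carrier (free_algebra (gens n))" "Y = quot n q" by (metis Q_cases)
  thus "act \<sigma> X \<in> carrier (Q n)"
    "act \<sigma> (X \<otimes>\<^bsub>Q n\<^esub> Y) = act \<sigma> X \<otimes>\<^bsub>Q n\<^esub> act \<sigma> Y"
    "act \<sigma> (X \<oplus>\<^bsub>Q n\<^esub> Y) = act \<sigma> X \<oplus>\<^bsub>Q n\<^esub> act \<sigma> Y"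
    by (simp_all add: act_quot[OF assms] quot_closed cl free_map_mult free_map_add
        flip: quot_mult quot_add)
next
  have "\<one>\<^bsub>Q n\<^esub> = (quot n (const 1) :: 'k Q_elt)"
    using ring_hom_memE(4)[OF quot_hom, of n, symmetric] by (simp add: free_algebra_def const_def)
  thus "act \<sigma> \<one>\<^bsub>Q n\<^esub> = (\<one>\<^bsub>Q n\<^esub> :: 'k Q_elt)" by (simp add: act_const[OF assms])
qed

lemma depends_only_on_set:
  fixes f :: "nat list \<Rightarrow> 'b"
  assumes step: "\<And>l b. distinct (l @ [b]) \<Longrightarrow> set (l @ [b]) \<subseteq> N \<Longrightarrow> f (l @ [b]) = F (set l) b (f l)"
    and comm: "\<And>l a b. distinct (l @ [a, b]) \<Longrightarrow> set (l @ [a, b]) \<subseteq> N \<Longrightarrow>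
      F (insert a (set l)) b (F (set l) a (f l)) = F (insert b (set l)) a (F (set l) b (f l))"
    and "distinct cs" "distinct ds" "set cs = set ds" "set cs \<subseteq> N"
  shows "f cs = f ds"
  using assms(3-)
proof (induction "length cs" arbitrary: cs ds rule: less_induct)
  case less
  show ?case
  proof (cases cs rule: rev_exhaust)
    case Nil
    thus ?thesis using less.prems by simp
  next
    case cs: (snoc bs a)
    then obtain es b where ds: "ds = es @ [b]" using less.prems by (cases ds rule: rev_exhaust) auto
    have IH: "f xs = f ys"
      if "length xs < length cs" "distinct xs" "distinct ys" "set xs = set ys" "set xs \<subseteq> N" for xs ys
      using less.hyps that by blast
    have "length ds = length cs"
      using distinct_card[OF less.prems(1)] distinct_card[OF less.prems(2)] less.prems(3) by simp
    hence len: "length es < length cs" using ds by simp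
    show ?thesis
    proof (cases "a = b")
      case True
      have "set bs = set es" using less.prems cs ds True by auto
      moreover from this have "f bs = f es" using less.prems cs ds by (intro IH) auto
      ultimately show ?thesis using less.prems cs ds True by (simp add: step)
    next
      case False
      obtain l where l: "set l = set cs - {a, b}" "distinct l"
        using finite_distinct_list[of "set cs - {a, b}"] by auto
      have bs: "set bs = set (l @ [b])" and es: "set es = set (l @ [a])"
        using less.prems cs ds False l by auto
      have d: "distinct bs" "distinct es" "a \<notin> set bs" "b \<notin> set es" "a \<in> N" "b \<in> N"
        "set bs \<subseteq> N" "set es \<subseteq> N"
        using less.prems(1,2,4) less.prems(3,4)[unfolded cs ds] by (auto simp: cs ds)
      have lN: "set l \<subseteq> N" and ab: "a \<notin> set l" "b \<notin> set l" using l less.prems(4) by auto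
      have "f bs = f (l @ [b])"
        by (rule IH) (simp add: cs, rule d, simp add: l(2) ab, rule bs, rule d)
      moreover have "f es = f (l @ [a])"
        by (rule IH) (rule len, rule d, simp add: l(2) ab, rule es, rule d)
      moreover have "f (l @ [b]) = F (set l) b (f l)" "f (l @ [a]) = F (set l) a (f l)"
        by (rule step; simp add: l(2) ab lN d)+
      moreover have "f cs = F (set bs) a (f bs)" "f ds = F (set es) b (f es)"
        unfolding cs ds by (rule step; simp add: d)+
      moreover have "F (insert a (set l)) b (F (set l) a (f l)) = F (insert b (set l)) a (F (set l) b (f l))"
        by (rule comm) (simp_all add: l(2) ab lN d False)
      ultimately show ?thesis by (simp add: bs es)
    qed
  qed
qed

lemma r_list_closed:
  assumes "distinct cs" "set cs \<subseteq> {1..n}" "k \<le> length cs"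
  shows "(\<lambda>i. z n (set (take i cs)) (cs ! i)) \<in> {..<k} \<rightarrow> carrier (Q n)"
proof
  fix i assume "i \<in> {..<k}"
  hence i: "i < length cs" using assms by simp
  have "cs ! i \<notin> set (take i cs)"
    using assms(1) i by (simp add: in_set_conv_nth nth_eq_iff_index_eq)
  moreover have "set (take i cs) \<subseteq> {1..n}" using assms(2) set_take_subset by (meson order_trans)
  ultimately show "z n (set (take i cs)) (cs ! i) \<in> carrier (Q n)"
    using assms i by (intro z_closed) (auto dest: subsetD[OF _ nth_mem])
qed

lemma r_eq_r_list:
  assumes "distinct cs" "set cs \<subseteq> {1..n}"
  shows "r n (set cs) = (r_list n cs :: 'k::field Q_elt)"
proof -
  interpret ring "Q n :: 'k Q_elt ring" by (rule ring_Q)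
  let ?r = "r_list n :: nat list \<Rightarrow> 'k Q_elt"
  have cl: "?r l \<in> carrier (Q n)" if "distinct l" "set l \<subseteq> {1..n}" for l
    unfolding r_list_def using r_list_closed[OF that order.refl] by (rule finsum_closed)
  show ?thesis
    unfolding r_def
  proof (rule depends_only_on_set[where N = "{1..n}" and F = "\<lambda>S b v. z n S b \<oplus>\<^bsub>Q n\<^esub> v"])
    fix l b assume l: "distinct (l @ [b])" "set (l @ [b]) \<subseteq> {1..n}"
    have "(\<lambda>i. z n (set (take i (l @ [b]))) ((l @ [b]) ! i) :: 'k Q_elt)
        \<in> {..<length l} \<rightarrow> carrier (Q n)"
      using r_list_closed[OF l, of "length l"] by simp
    moreover have "z n (set l) b \<in> (carrier (Q n) :: 'k Q_elt set)"
      using l by (intro z_closed) auto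
    ultimately have "?r (l @ [b]) = z n (set l) b \<oplus>\<^bsub>Q n\<^esub>
        (\<Oplus>\<^bsub>Q n\<^esub>i\<in>{..<length l}. z n (set (take i (l @ [b]))) ((l @ [b]) ! i))"
      unfolding r_list_def
      by (simp add: lessThan_Suc)
    also have "(\<Oplus>\<^bsub>Q n\<^esub>i\<in>{..<length l}. z n (set (take i (l @ [b]))) ((l @ [b]) ! i)) = ?r l"
      unfolding r_list_def
      by (rule finsum_cong') (use r_list_closed[of l n "length l"] l in \<open>auto simp: nth_append\<close>)
    finally show "?r (l @ [b]) = z n (set l) b \<oplus>\<^bsub>Q n\<^esub> ?r l" .
  next
    fix l a b assume l: "distinct (l @ [a, b])" "set (l @ [a, b]) \<subseteq> {1..n}"
    hence zc: "z n (insert a (set l)) b \<in> (carrier (Q n) :: 'k Q_elt set)"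
      "z n (set l) a \<in> (carrier (Q n) :: 'k Q_elt set)"
      "z n (insert b (set l)) a \<in> (carrier (Q n) :: 'k Q_elt set)"
      "z n (set l) b \<in> (carrier (Q n) :: 'k Q_elt set)"
      by (auto intro!: z_closed)
    have "z n (insert a (set l)) b \<oplus>\<^bsub>Q n\<^esub> z n (set l) a
        = (z n (insert b (set l)) a \<oplus>\<^bsub>Q n\<^esub> z n (set l) b :: 'k Q_elt)"
      using l by (intro z_add) auto
    thus "z n (insert a (set l)) b \<oplus>\<^bsub>Q n\<^esub> (z n (set l) a \<oplus>\<^bsub>Q n\<^esub> ?r l)
        = z n (insert b (set l)) a \<oplus>\<^bsub>Q n\<^esub> (z n (set l) b \<oplus>\<^bsub>Q n\<^esub> ?r l)"
      using zc cl[of l] l by (simp flip: a_assoc)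
  qed (use assms in auto)
qed

lemma lin_factor_closed: "a \<in> carrier (Q n) \<Longrightarrow> lin_factor n a \<in> carrier (UP (Q n))"
proof -
  interpret UP_ring "Q n" "UP (Q n)" by (intro UP_ring.intro ring_Q)
  show "a \<in> carrier (Q n) \<Longrightarrow> lin_factor n a \<in> carrier (UP (Q n))"
    by (simp add: lin_factor_def)
qed

lemma lin_factor_swap:
  assumes cl: "a \<in> (carrier (Q n) :: 'k::field Q_elt set)" "b \<in> carrier (Q n)" "c \<in> carrier (Q n)" "d \<in> carrier (Q n)"
    and "a \<oplus>\<^bsub>Q n\<^esub> b = c \<oplus>\<^bsub>Q n\<^esub> d" "a \<otimes>\<^bsub>Q n\<^esub> b = c \<otimes>\<^bsub>Q n\<^esub> d"
  shows "lin_factor n a \<otimes>\<^bsub>UP (Q n)\<^esub> lin_factor n b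
    = lin_factor n c \<otimes>\<^bsub>UP (Q n)\<^esub> lin_factor n d"
proof -
  interpret UP_ring "Q n" "UP (Q n)" by (intro UP_ring.intro ring_Q)
  let ?X = "monom (UP (Q n)) \<one>\<^bsub>Q n\<^esub> 1" and ?C = "\<lambda>a. monom (UP (Q n)) a 0"
  have expand: "lin_factor n a \<otimes>\<^bsub>UP (Q n)\<^esub> lin_factor n b
      = ?X \<otimes>\<^bsub>UP (Q n)\<^esub> ?X \<ominus>\<^bsub>UP (Q n)\<^esub> ?C (a \<oplus>\<^bsub>Q n\<^esub> b) \<otimes>\<^bsub>UP (Q n)\<^esub> ?X
        \<oplus>\<^bsub>UP (Q n)\<^esub> ?C (a \<otimes>\<^bsub>Q n\<^esub> b)"
    if "a \<in> carrier (Q n)" "b \<in> carrier (Q n)" for a b :: "'k Q_elt"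
  proof -
    have "?X \<otimes>\<^bsub>UP (Q n)\<^esub> ?C b = ?C b \<otimes>\<^bsub>UP (Q n)\<^esub> ?X"
      using monom_mult[of "\<one>\<^bsub>Q n\<^esub>" b 1 0] monom_mult[of b "\<one>\<^bsub>Q n\<^esub>" 0 1] that by simp
    moreover have "?C (a \<otimes>\<^bsub>Q n\<^esub> b) = ?C a \<otimes>\<^bsub>UP (Q n)\<^esub> ?C b"
      using monom_mult[of a b 0 0] that by simp
    moreover have "?C a \<in> carrier (UP (Q n))" "?C b \<in> carrier (UP (Q n))"
      "?X \<in> carrier (UP (Q n))" using that by auto
    ultimately show ?thesis
      using that by (simp add: lin_factor_def a_minus_def P.l_distr P.r_distr P.l_minus P.r_minus
          P.minus_add P.minus_minus P.a_ac)
  qed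
  show ?thesis using assms by (simp only: expand)
qed

definition P_list :: "nat \<Rightarrow> nat list \<Rightarrow> nat \<Rightarrow> 'k::field Q_elt" where
  "P_list n cs = foldr (\<lambda>i p. lin_factor n (z n (set (take i cs)) (cs ! i)) \<otimes>\<^bsub>UP (Q n)\<^esub> p)
     (rev [0..<length cs]) \<one>\<^bsub>UP (Q n)\<^esub>"

lemma P_list_snoc:
  "P_list n (l @ [b])
    = (lin_factor n (z n (set l) b) \<otimes>\<^bsub>UP (Q n)\<^esub> P_list n l :: nat \<Rightarrow> 'k::field Q_elt)"
proof -
  have "foldr (\<lambda>i p. lin_factor n (z n (set (take i (l @ [b]))) ((l @ [b]) ! i)) \<otimes>\<^bsub>UP (Q n)\<^esub> p)
     (rev [0..<length l]) \<one>\<^bsub>UP (Q n)\<^esub> = (P_list n l :: nat \<Rightarrow> 'k Q_elt)"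
    unfolding P_list_def by (rule foldr_cong) (auto simp: nth_append)
  moreover have "take (length l) (l @ [b]) = l" by simp
  ultimately show ?thesis
    unfolding P_list_def[of n "l @ [b]"] by (simp del: take_append)
qed

lemma P_list_closed:
  "distinct l \<Longrightarrow> set l \<subseteq> {1..n} \<Longrightarrow> P_list n l \<in> carrier (UP (Q n))"
proof (induction l rule: rev_induct)
  interpret UP_ring "Q n" "UP (Q n)" by (intro UP_ring.intro ring_Q)
  case Nil
  show ?case by (simp add: P_list_def)
next
  interpret UP_ring "Q n" "UP (Q n)" by (intro UP_ring.intro ring_Q)
  case (snoc b l)
  thus ?case by (auto simp: P_list_snoc intro!: UP_mult_closed lin_factor_closed z_closed)
qed

lemma P_eq_P_list: "P n \<sigma> = (P_list n (map \<sigma> [1..<Suc n]) :: nat \<Rightarrow> 'k::field Q_elt)"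
proof -
  have "rev [1..<Suc n] = map Suc (rev [0..<n])" by (simp only: rev_map[symmetric] map_Suc_upt One_nat_def)
  hence "P n \<sigma> = (foldr (\<lambda>m p. lin_factor n (y n \<sigma> (Suc m)) \<otimes>\<^bsub>UP (Q n)\<^esub> p) (rev [0..<n])
      \<one>\<^bsub>UP (Q n)\<^esub> :: nat \<Rightarrow> 'k Q_elt)"
    by (simp only: P_def foldr_map o_def)
  also have "\<dots> = P_list n (map \<sigma> [1..<Suc n])"
    unfolding P_list_def
    by (rule foldr_cong) (auto simp: y_def take_map simp del: upt_Suc)
  finally show ?thesis .
qed

lemma P_indep:
  assumes "\<sigma> permutes {1..n}" "\<tau> permutes {1..n}"
  shows "P n \<sigma> = (P n \<tau> :: nat \<Rightarrow> 'k::field Q_elt)"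
proof -
  interpret UP_ring "Q n" "UP (Q n) :: ('k Q_elt, nat \<Rightarrow> 'k Q_elt) up_ring"
    by (intro UP_ring.intro ring_Q)
  have set: "set (map \<rho> [1..<Suc n]) = {1..n}" "distinct (map \<rho> [1..<Suc n])"
    if "\<rho> permutes {1..n}" for \<rho>
    using permutes_image[OF that] permutes_inj[OF that]
    by (auto simp: distinct_map atLeastLessThanSuc_atLeastAtMost simp del: upt_Suc
        intro: inj_on_subset)
  show ?thesis
    unfolding P_eq_P_list
  proof (rule depends_only_on_set[where N = "{1..n}" and
        F = "\<lambda>S b v. lin_factor n (z n S b) \<otimes>\<^bsub>UP (Q n)\<^esub> v"])
    fix l a b assume l: "distinct (l @ [a, b])" "set (l @ [a, b]) \<subseteq> {1..n}"
    hence zc: "z n (insert a (set l)) b \<in> (carrier (Q n) :: 'k Q_elt set)"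
      "z n (set l) a \<in> (carrier (Q n) :: 'k Q_elt set)"
      "z n (insert b (set l)) a \<in> (carrier (Q n) :: 'k Q_elt set)"
      "z n (set l) b \<in> (carrier (Q n) :: 'k Q_elt set)"
      by (auto intro!: z_closed)
    have pl: "P_list n l \<in> (carrier (UP (Q n)) :: (nat \<Rightarrow> 'k Q_elt) set)"
      using l by (intro P_list_closed) auto
    have "lin_factor n (z n (insert a (set l)) b) \<otimes>\<^bsub>UP (Q n)\<^esub> lin_factor n (z n (set l) a)
      = (lin_factor n (z n (insert b (set l)) a) \<otimes>\<^bsub>UP (Q n)\<^esub> lin_factor n (z n (set l) b)
          :: nat \<Rightarrow> 'k Q_elt)"
      using l by (intro lin_factor_swap zc z_add z_mult) auto
    thus "lin_factor n (z n (insert a (set l)) b) \<otimes>\<^bsub>UP (Q n)\<^esub>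
          (lin_factor n (z n (set l) a) \<otimes>\<^bsub>UP (Q n)\<^esub> P_list n l)
      = (lin_factor n (z n (insert b (set l)) a) \<otimes>\<^bsub>UP (Q n)\<^esub>
          (lin_factor n (z n (set l) b) \<otimes>\<^bsub>UP (Q n)\<^esub> P_list n l) :: nat \<Rightarrow> 'k Q_elt)"
      using zc pl by (simp add: lin_factor_closed flip: P.m_assoc)
  qed (use set[OF assms(1)] set[OF assms(2)] in \<open>simp_all add: P_list_snoc\<close>)
qed

end

theory Submission
  imports Defs "HOL-Library.List_Lenlexorder"
begin

text \<open>
  Let \<open>F\<close> be the free algebra on letters \<open>x\<^sub>1, \<dots>, x\<^sub>n\<close>.  For each permutation \<open>\<tau>\<close>,
  substituting \<open>y\<^sub>m\<^sub>,\<^sub>\<tau>\<close> for \<open>x\<^sub>m\<close> is an algebra homomorphism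
  \<open>chain_eval n \<tau> : F \<rightarrow> Q\<^sub>n\<close>.  Its image is \<open>Q\<^sub>n\<^sub>,\<^sub>\<tau>\<close>, because \<open>r\<close> of an initial segment is a partial
  sum of the \<open>y\<^sub>m\<^sub>,\<^sub>\<tau>\<close> (\<open>Q_perm_eq\<close>), and \<open>\<sigma>\<close> carries \<open>chain_eval n \<tau>\<close> to
  \<open>chain_eval n (\<sigma> \<circ> \<tau>)\<close>.  Every \<open>chain_eval n \<tau>\<close> sends the coefficients of the generic product
  \<open>(t - x\<^sub>n) \<cdots> (t - x\<^sub>1)\<close> to those of \<open>P(t)\<close> (\<open>coeff_P\<close>), and \<open>P(t)\<close> does not depend on \<open>\<tau>\<close>;
  so these coefficients lie in every \<open>Q\<^sub>n\<^sub>,\<^sub>\<tau>\<close> and are invariant.  An invariant element of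
  \<open>Q\<^sub>n\<^sub>,\<^sub>\<sigma>\<close> is fixed by \<open>\<tau> \<circ> \<sigma>\<inverse>\<close>, which maps \<open>Q\<^sub>n\<^sub>,\<^sub>\<sigma>\<close> to \<open>Q\<^sub>n\<^sub>,\<^sub>\<tau>\<close>, hence it lies in every
  \<open>Q\<^sub>n\<^sub>,\<^sub>\<tau>\<close>.  What remains is that the intersection is generated by the coefficients of \<open>P(t)\<close>.

  Let \<open>chain_eval n id f\<close> lie in the intersection and let \<open>1 \<le> a < n\<close>.  The chain of subsets
  belonging to the transposition \<open>s\<close> of \<open>a\<close> and \<open>a + 1\<close> differs from the standard one only in having
  \<open>{1..a - 1} \<union> {a + 1}\<close> in place of \<open>{1..a}\<close>.  Accordingly there is an action of \<open>Q\<^sub>n\<close> on the span of all words in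
  \<open>x\<^sub>1, \<dots>, x\<^sub>n\<close> and a marker \<open>x\<^sub>0\<close> that sees this set: \<open>z\<^sub>A\<^sub>,\<^sub>j\<close> acts as left multiplication by
  \<open>x\<close> with index \<open>|A| + 1\<close>, plus an operator \<open>H\<close> if \<open>A \<union> {j} = {1..a}\<close>, minus \<open>H\<close> if \<open>A = {1..a}\<close>.
  The relations of \<open>Q\<^sub>n\<close> come down to \<open>H x\<^sub>a = x\<^sub>a\<^sub>+\<^sub>1 H\<close> and \<open>H H = 0\<close>, and
  \<open>H (x\<^sub>a\<^sup>k w) = x\<^sub>a\<^sub>+\<^sub>1\<^sup>k x\<^sub>0 w\<close>, for unmarked words \<open>w\<close> not starting with \<open>x\<^sub>a\<close>, defines such an operator.
  Elements of \<open>Q\<^sub>n\<^sub>,\<^sub>s\<close> act by plain multiplications, so applying \<open>chain_eval n id f\<close> to the empty word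
  gives no marked words.  Reading off one marked coefficient shows that in the largest word of \<open>f\<close>,
  compared by length and then lexicographically, each letter \<open>a\<close> directly follows a letter \<open>a + 1\<close>
  (\<open>leading_word_descends\<close>).

  This holds for all \<open>a < n\<close>, so the largest word of \<open>f\<close> is a concatenation of runs
  \<open>n, n - 1, \<dots>, m + 1\<close>.  Up to sign these runs are the leading terms of the coefficients of the generic product
  (\<open>has_lead_generic_coeff\<close>), so some scalar multiple of a product of such coefficients has the same leading
  term as \<open>f\<close>.  Subtracting it from \<open>f\<close> stays inside the intersection and makes the largest word
  smaller; the order on words is well-founded, so \<open>f\<close> is used up after finitely many steps.
\<close>

section \<open>Free algebras and linear extension from words\<close>

abbreviation coef where "coef p w \<equiv> Poly_Mapping.lookup p (Mon w)"

lemma free_algebra_mono: "G \<subseteq> H \<Longrightarrow> carrier (free_algebra G) \<subseteq> carrier (free_algebra H)"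
  by (auto simp: free_algebra_def)

definition lin_ext ::
    "('a free_mon \<Rightarrow> ('b free_mon \<Rightarrow>\<^sub>0 'k)) \<Rightarrow> ('a free_mon \<Rightarrow>\<^sub>0 'k::field) \<Rightarrow> ('b free_mon \<Rightarrow>\<^sub>0 'k)" where
  "lin_ext \<phi> p = (\<Sum>w\<in>Poly_Mapping.keys p. const (Poly_Mapping.lookup p w) * \<phi> w)"

lemma const_0 [simp]: "const 0 = 0" by (simp add: const_def)
lemma const_1 [simp]: "const 1 = 1" by (simp add: const_def)
lemma const_add: "const (c + d) = const c + const d" by (simp add: const_def single_add)
lemma const_mult: "const (c * d) = const c * const d" by (simp add: const_def mult_single)
lemma const_uminus: "const (- c) = - const c" by (simp add: const_def single_uminus)

lemma const_times_single: "const c * Poly_Mapping.single w d = Poly_Mapping.single w (c * d)"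
  by (simp add: const_def mult_single)

lemma single_times_const: "Poly_Mapping.single w d * const c = Poly_Mapping.single w (d * c)"
  by (simp add: const_def mult_single)

lemma lookup_const_times: "Poly_Mapping.lookup (const c * p) w = c * Poly_Mapping.lookup p w"
proof -
  have "const c * p = Poly_Mapping.map ((*) c) p"
    by (simp add: const_def mult_map_scale_conv_mult)
  thus ?thesis by (simp add: map.rep_eq when_def)
qed

lemma lookup_times_const: "Poly_Mapping.lookup (p * const c) w = Poly_Mapping.lookup p w * c"
proof -
  have "p * const c = (\<Sum>w\<in>Poly_Mapping.keys p. Poly_Mapping.single w (Poly_Mapping.lookup p w * c))"
    by (subst sum_single_keys[of p, symmetric]) (simp add: sum_distrib_right single_times_const)
  thus ?thesis by (auto simp: lookup_sum lookup_single when_def in_keys_iff)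
qed

lemma const_comm: "const c * p = p * const c"
  by (rule poly_mapping_eqI) (simp add: lookup_const_times lookup_times_const mult.commute)

lemma lin_ext_superset:
  assumes "finite S" "Poly_Mapping.keys p \<subseteq> S"
  shows "lin_ext \<phi> p = (\<Sum>w\<in>S. const (Poly_Mapping.lookup p w) * \<phi> w)"
  unfolding lin_ext_def using assms by (intro sum.mono_neutral_left) (auto simp: in_keys_iff)

lemma lin_ext_0 [simp]: "lin_ext \<phi> 0 = 0"
  by (simp add: lin_ext_def)

lemma lin_ext_add: "lin_ext \<phi> (p + q) = lin_ext \<phi> p + lin_ext \<phi> q"
proof -
  let ?S = "Poly_Mapping.keys p \<union> Poly_Mapping.keys q"
  have "Poly_Mapping.keys (p + q) \<subseteq> ?S" by (rule keys_add)
  thus ?thesis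
    by (simp add: lin_ext_superset[of ?S] lookup_add const_add distrib_right sum.distrib)
qed

lemma lin_ext_sum: "lin_ext \<phi> (\<Sum>i\<in>I. p i) = (\<Sum>i\<in>I. lin_ext \<phi> (p i))"
  by (induction I rule: infinite_finite_induct) (simp_all add: lin_ext_add)

lemma lin_ext_single: "lin_ext \<phi> (Poly_Mapping.single w c) = const c * \<phi> w"
  by (cases "c = 0") (simp_all add: lin_ext_def)

lemma lin_ext_const_times: "lin_ext \<phi> (const c * p) = const c * lin_ext \<phi> p"
proof -
  have "const c * p = (\<Sum>w\<in>Poly_Mapping.keys p. Poly_Mapping.single w (c * Poly_Mapping.lookup p w))"
    by (subst sum_single_keys[of p, symmetric]) (simp add: sum_distrib_left const_times_single)
  thus ?thesis
    by (simp add: lin_ext_sum lin_ext_single const_mult)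
      (simp add: lin_ext_def sum_distrib_left mult.assoc)
qed

lemma lin_ext_minus: "lin_ext \<phi> (p - q) = lin_ext \<phi> p - lin_ext \<phi> q"
  using lin_ext_add[of \<phi> "p - q" q] by simp

lemma lookup_lin_ext:
  "Poly_Mapping.lookup (lin_ext \<phi> p) w
    = (\<Sum>u\<in>Poly_Mapping.keys p. Poly_Mapping.lookup p u * Poly_Mapping.lookup (\<phi> u) w)"
  by (simp add: lin_ext_def lookup_sum lookup_const_times)

lemma var_times_single: "var l * Poly_Mapping.single (Mon w) c = Poly_Mapping.single (Mon (l # w)) c"
  by (simp add: var_def mult_single plus_free_mon_def)

lemma var_times_eq:
  "var l * p = (\<Sum>u\<in>Poly_Mapping.keys p. Poly_Mapping.single (Mon (l # letters u)) (Poly_Mapping.lookup p u))"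
proof -
  have "var l * p = (\<Sum>u\<in>Poly_Mapping.keys p. var l * Poly_Mapping.single (Mon (letters u)) (Poly_Mapping.lookup p u))"
    by (subst sum_single_keys[of p, symmetric]) (simp add: sum_distrib_left)
  thus ?thesis by (simp only: var_times_single)
qed

lemma keys_var_times: "w \<in> Poly_Mapping.keys (var l * p) \<Longrightarrow> \<exists>u\<in>Poly_Mapping.keys p. w = Mon (l # letters u)"
  using keys_mult[of "var l" p] by (auto simp: var_def plus_free_mon_def)

lemma lookup_var_times_Cons:
  "Poly_Mapping.lookup (var l * p) (Mon (m # w)) = (if l = m then Poly_Mapping.lookup p (Mon w) else 0)"
proof -
  have "Mon w = u" if "letters u = w" for u using that by (metis free_mon.collapse)
  hence "(Mon (l # letters u) = Mon (m # w)) = (l = m \<and> u = Mon w)" for u by auto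
  thus ?thesis
    unfolding var_times_eq lookup_sum lookup_single
    by (auto simp: when_def in_keys_iff)
qed

lemma lookup_var_times_Nil: "Poly_Mapping.lookup (var l * p) (Mon []) = 0"
  unfolding var_times_eq lookup_sum lookup_single by (simp add: when_def)

lemma free_algebra_induct [consumes 1, case_names const var add mult]:
  assumes f: "f \<in> carrier (free_algebra G)"
    and const: "\<And>c. S (const c)" and var: "\<And>g. g \<in> G \<Longrightarrow> S (var g)"
    and add: "\<And>p q. p \<in> carrier (free_algebra G) \<Longrightarrow> q \<in> carrier (free_algebra G) \<Longrightarrow> S p \<Longrightarrow> S q \<Longrightarrow> S (p + q)"
    and mult: "\<And>p q. p \<in> carrier (free_algebra G) \<Longrightarrow> q \<in> carrier (free_algebra G) \<Longrightarrow> S p \<Longrightarrow> S q \<Longrightarrow> S (p * q)"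
  shows "S f"
proof -
  let ?F = "carrier (free_algebra G)"
  have mon: "Poly_Mapping.single (Mon w) c \<in> ?F \<and> S (Poly_Mapping.single (Mon w) c)" if "set w \<subseteq> G" for w c
    using that
  proof (induction w)
    case Nil
    show ?case using const[of c] const_closed[of c] by (simp add: const_def zero_free_mon_def)
  next
    case (Cons l w)
    hence w: "Poly_Mapping.single (Mon w) c \<in> ?F" "S (Poly_Mapping.single (Mon w) c)"
      and l: "l \<in> G" "var l \<in> ?F"
      by (auto intro: var_closed)
    from mult[OF l(2) w(1) var[OF l(1)] w(2)] free_closed(2)[OF l(2) w(1)] show ?case
      by (simp add: var_times_single)
  qed
  have "(\<Sum>w\<in>W. Poly_Mapping.single w (Poly_Mapping.lookup f w)) \<in> ?F
      \<and> S (\<Sum>w\<in>W. Poly_Mapping.single w (Poly_Mapping.lookup f w))"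
    if "finite W" "W \<subseteq> Poly_Mapping.keys f" for W
    using that
  proof (induction W)
    case empty
    show ?case using const[of 0] const_closed[of 0 G] by simp
  next
    case (insert w W)
    have "set (letters w) \<subseteq> G" using f insert.prems by (auto simp: free_algebra_def)
    from mon[OF this] insert show ?case by (auto intro: add free_closed)
  qed
  from this[of "Poly_Mapping.keys f"] show ?thesis by (simp add: sum_single_keys)
qed

section \<open>Representations of \<open>Q\<^sub>n\<close> given by operators on words\<close>

text \<open>The operator by which \<open>p\<close> acts when every generator \<open>g\<close> acts as \<open>T g\<close>.\<close>

definition op_ext ::
    "('g \<Rightarrow> ('b free_mon \<Rightarrow>\<^sub>0 'k) \<Rightarrow> ('b free_mon \<Rightarrow>\<^sub>0 'k))
      \<Rightarrow> ('g free_mon \<Rightarrow>\<^sub>0 'k::field) \<Rightarrow> ('b free_mon \<Rightarrow>\<^sub>0 'k) \<Rightarrow> ('b free_mon \<Rightarrow>\<^sub>0 'k)" where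
  "op_ext T p v = lin_ext (\<lambda>w. foldr T (letters w) v) p"

definition linear_op :: "(('b free_mon \<Rightarrow>\<^sub>0 'k::field) \<Rightarrow> ('b free_mon \<Rightarrow>\<^sub>0 'k)) \<Rightarrow> bool" where
  "linear_op f \<longleftrightarrow> (\<forall>u v. f (u + v) = f u + f v) \<and> (\<forall>c v. f (const c * v) = const c * f v)"

lemma linear_opD:
  assumes "linear_op f"
  shows "f (u + v) = f u + f v" "f (const c * v) = const c * f v" "f 0 = 0"
    "f (sum h I) = (\<Sum>i\<in>I. f (h i))"
proof -
  show 1: "f (u + v) = f u + f v" "f (const c * v) = const c * f v" for u v c
    using assms by (auto simp: linear_op_def)
  show 2: "f 0 = 0" using 1(2)[of 0 0] by simp
  show "f (sum h I) = (\<Sum>i\<in>I. f (h i))"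
    by (induction I rule: infinite_finite_induct) (simp_all add: 1 2)
qed

lemma linear_op_lin_ext: "linear_op (lin_ext \<phi>)"
  by (simp add: linear_op_def lin_ext_add lin_ext_const_times)

lemma linear_op_foldr:
  "(\<And>g. g \<in> set l \<Longrightarrow> linear_op (T g)) \<Longrightarrow> linear_op (foldr T l)"
  by (induction l) (simp_all add: linear_op_def)

lemma op_ext_add: "op_ext T (p + q) v = op_ext T p v + op_ext T q v"
  by (simp add: op_ext_def lin_ext_add)

lemma op_ext_minus: "op_ext T (p - q) v = op_ext T p v - op_ext T q v"
  by (simp add: op_ext_def lin_ext_minus)

lemma op_ext_uminus: "op_ext T (- p) v = - op_ext T p v"
  using op_ext_minus[of T 0 p v] by (simp add: op_ext_def)

lemma op_ext_var: "op_ext T (var g) v = T g v"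
  by (simp add: op_ext_def var_def lin_ext_single)

text \<open>Concatenated words act by composition, and linearity of the operators extends this to sums of words.\<close>

lemma op_ext_times:
  assumes "\<And>g. linear_op (T g)"
  shows "op_ext T (p * q) v = op_ext T p (op_ext T q v)"
proof -
  let ?s = "\<lambda>p. \<Sum>w\<in>Poly_Mapping.keys p. Poly_Mapping.single w (Poly_Mapping.lookup p w)"
  note lin = linear_opD[OF linear_op_foldr[of _ T, OF assms]]
  have "op_ext T (?s p * ?s q) v = (\<Sum>i\<in>Poly_Mapping.keys p. \<Sum>j\<in>Poly_Mapping.keys q. const (Poly_Mapping.lookup p i * Poly_Mapping.lookup q j) * foldr T (letters i) (foldr T (letters j) v))"
    by (simp add: op_ext_def sum_product lin_ext_sum mult_single lin_ext_single plus_free_mon_def)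
  also have "\<dots> = op_ext T p (op_ext T q v)"
    by (simp add: op_ext_def lin_ext_def lin const_mult sum_distrib_left mult.assoc)
  finally show ?thesis by (simp add: sum_single_keys)
qed

lemma op_ext_zero: assumes "\<And>g. linear_op (T g)" shows "op_ext T p 0 = 0"
  using linear_opD(3)[OF linear_op_foldr[of _ T, OF assms]]
  by (simp add: op_ext_def lin_ext_def)

lemma op_ext_free_map: "op_ext T (free_map g p) v = op_ext (\<lambda>x. T (g x)) p v"
proof -
  have "foldr T (map g l) v = foldr (\<lambda>x. T (g x)) l v" for l
    by (induction l) auto
  thus ?thesis
    by (simp add: op_ext_def free_map_def lin_ext_sum lin_ext_single map_mon_def)
      (simp add: lin_ext_def)
qed

text \<open>Operators that satisfy the defining relations represent \<open>Q\<^sub>n\<close>: the elements of the free algebra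
  that act as zero form an ideal, and this ideal contains the relations.\<close>

lemma op_ext_quot_cong:
  fixes p q :: "'k::field free_elt"
  assumes lin: "\<And>g. linear_op (T g)"
    and add: "\<And>A i j v. A \<subseteq> {1..n} \<Longrightarrow> i \<in> {1..n} - A \<Longrightarrow> j \<in> {1..n} - A \<Longrightarrow> i \<noteq> j \<Longrightarrow>
      T (insert i A, j) v + T (A, i) v = T (insert j A, i) v + T (A, j) v"
    and mult: "\<And>A i j v. A \<subseteq> {1..n} \<Longrightarrow> i \<in> {1..n} - A \<Longrightarrow> j \<in> {1..n} - A \<Longrightarrow> i \<noteq> j \<Longrightarrow>
      T (insert i A, j) (T (A, i) v) = T (insert j A, i) (T (A, j) v)"
    and pq: "p \<in> carrier (free_algebra (gens n))" "q \<in> carrier (free_algebra (gens n))"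
      "quot n p = quot n q"
  shows "op_ext T p v = op_ext T q v"
proof -
  let ?F = "free_algebra (gens n) :: 'k free_elt ring"
  let ?K = "{p \<in> carrier ?F. \<forall>v. op_ext T p v = 0}"
  interpret ring ?F by (rule ring_free_algebra)
  have inv: "\<ominus>\<^bsub>?F\<^esub> p = 0 - p" if "p \<in> carrier ?F" for p
  proof -
    have "\<ominus>\<^bsub>?F\<^esub> p = \<zero>\<^bsub>?F\<^esub> \<ominus>\<^bsub>?F\<^esub> p" using that by (simp add: a_minus_def)
    also have "\<dots> = \<zero>\<^bsub>?F\<^esub> - p" using that by (simp add: a_minus_free_algebra)
    finally show ?thesis by (simp add: free_algebra_def)
  qed
  have "ideal ?K ?F"
  proof (rule idealI[OF ring_free_algebra])
    show "subgroup ?K (add_monoid ?F)"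
    proof (rule add.subgroupI)
      show "?K \<noteq> {}" by (rule ex_in_conv[THEN iffD1], rule exI[of _ 0])
          (simp add: op_ext_def, simp add: free_algebra_def)
      show "\<ominus>\<^bsub>?F\<^esub> a \<in> ?K" if "a \<in> ?K" for a
        using that a_inv_closed[of a] by (simp add: inv op_ext_uminus)
      show "a \<oplus>\<^bsub>?F\<^esub> b \<in> ?K" if "a \<in> ?K" "b \<in> ?K" for a b
        using that a_closed[of a b] op_ext_add[of T a b] by (simp add: free_algebra_def)
    qed auto
    show "x \<otimes>\<^bsub>?F\<^esub> a \<in> ?K" if "a \<in> ?K" "x \<in> carrier ?F" for a x
      using that m_closed[of x a] op_ext_times[where T = T and p = x and q = a, OF lin] op_ext_zero[OF lin]
      by (simp add: free_algebra_def)
    show "a \<otimes>\<^bsub>?F\<^esub> x \<in> ?K" if "a \<in> ?K" "x \<in> carrier ?F" for a x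
      using that m_closed[of a x] op_ext_times[where T = T and p = a and q = x, OF lin]
      by (simp add: free_algebra_def)
  qed
  moreover have "rels n \<subseteq> ?K"
  proof
    fix x :: "'k free_elt" assume "x \<in> rels n"
    moreover from this have "x \<in> carrier ?F" using rels_closed by blast
    ultimately show "x \<in> ?K" unfolding rels_def
      by (auto simp: op_ext_add op_ext_minus op_ext_times[OF lin] op_ext_var add mult)
  qed
  ultimately have "rel_ideal n \<subseteq> ?K" unfolding rel_ideal_def by (rule genideal_minimal)
  moreover have "p - q \<in> rel_ideal n"
    using quotient_eq_iff_same_a_r_cos[OF rel_ideal pq(1,2)] pq(3)
    by (simp add: quot_def a_minus_free_algebra pq)
  ultimately have "op_ext T (p - q) v = 0" by blast
  thus ?thesis by (simp add: op_ext_minus)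
qed


section \<open>The twisted action\<close>

text \<open>The normal form of \<open>H w\<close> when \<open>H x\<^sub>a = x\<^sub>a\<^sub>+\<^sub>1 H\<close> is used to move \<open>H\<close> to the right as far as possible.
  The marker \<open>0\<close> shows where it stops; the letters of words in \<open>F\<close> are \<open>1, \<dots>, n\<close>, so \<open>0\<close> is free for
  this purpose.\<close>

fun slide :: "nat \<Rightarrow> nat list \<Rightarrow> nat list" where
  "slide a [] = [0]"
| "slide a (l # w) = (if l = a then Suc a # slide a w else 0 # l # w)"

lemma length_slide: "length (slide a w) = Suc (length w)"
  by (induction w) auto

lemma slide_inject: "slide a u = slide a w \<Longrightarrow> u = w"
proof (induction u arbitrary: w)
  case Nil
  thus ?case by (cases w) (auto split: if_splits)
next
  case (Cons l u)
  thus ?case by (cases w) (auto split: if_splits)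
qed

lemma zero_in_slide: "0 \<in> set (slide a w)"
  by (induction w) auto

lemma slide_prefix: "slide a w = u @ x \<Longrightarrow> 0 \<notin> set u \<Longrightarrow> set u \<subseteq> {Suc a}"
proof (induction u arbitrary: w)
  case Nil
  thus ?case by simp
next
  case (Cons l u)
  thus ?case by (cases w) (auto split: if_splits)
qed

text \<open>The operator \<open>H\<close>.  Sending marked words to zero makes its square vanish.\<close>

definition slide_op :: "nat \<Rightarrow> (nat free_mon \<Rightarrow>\<^sub>0 'k::field) \<Rightarrow> (nat free_mon \<Rightarrow>\<^sub>0 'k)" where
  "slide_op a = lin_ext (\<lambda>w. if 0 \<in> set (letters w) then 0 else Poly_Mapping.single (Mon (slide a (letters w))) 1)"

text \<open>The coefficient of \<open>H\<close>: \<open>1\<close> for a step into the set \<open>{1..a}\<close> and \<open>-1\<close> for a step out of it.\<close>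

definition twist :: "nat \<Rightarrow> nat set \<Rightarrow> nat \<Rightarrow> 'k::field" where
  "twist a A j = of_bool (insert j A = {1..a}) - of_bool (A = {1..a})"

definition twisted_action ::
    "nat \<Rightarrow> gen \<Rightarrow> (nat free_mon \<Rightarrow>\<^sub>0 'k::field) \<Rightarrow> (nat free_mon \<Rightarrow>\<^sub>0 'k)" where
  "twisted_action a = (\<lambda>(A, j) v. var (Suc (card A)) * v + const (twist a A j) * slide_op a v)"

lemma linear_op_slide_op: "linear_op (slide_op a)"
  unfolding slide_op_def by (rule linear_op_lin_ext)

lemmas slide_op_linear = linear_opD[OF linear_op_slide_op]

lemma linear_op_twisted_action: "linear_op (twisted_action a g)"
proof (cases g)
  case (Pair A j)
  have "var l * (const c * v) = const c * (var l * v)"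
    "const d * (const c * v) = const c * (const d * v)" for l c d and v :: "nat free_mon \<Rightarrow>\<^sub>0 'a"
    by (simp_all add: const_comm[of c] mult.assoc)
  note comm = this(1) this(2)[of "twist a A j"]
  show ?thesis unfolding Pair linear_op_def twisted_action_def
    by (simp add: slide_op_linear distrib_left comm add_ac)
qed

lemma slide_op_marked:
  assumes "\<And>w. w \<in> Poly_Mapping.keys v \<Longrightarrow> 0 \<in> set (letters w)"
  shows "slide_op a v = 0"
  unfolding slide_op_def lin_ext_def using assms by (auto intro!: sum.neutral)

lemma slide_op_slide_op: "slide_op a (slide_op a v) = 0"
proof (rule slide_op_marked)
  fix w assume "w \<in> Poly_Mapping.keys (slide_op a v)"
  hence "Poly_Mapping.lookup (slide_op a v) w \<noteq> 0" by (simp add: in_keys_iff)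
  then obtain u where "Poly_Mapping.lookup (if 0 \<in> set (letters u) then 0 else Poly_Mapping.single (Mon (slide a (letters u))) 1 :: nat free_mon \<Rightarrow>\<^sub>0 'a) w \<noteq> 0"
    unfolding slide_op_def lookup_lin_ext by (auto elim!: sum.not_neutral_contains_not_neutral)
  thus "0 \<in> set (letters w)"
    using zero_in_slide by (auto simp: lookup_single when_def split: if_splits)
qed

text \<open>The commutation rule that the quadratic relations demand; \<^const>\<open>slide\<close> is designed for it.\<close>

lemma slide_op_var_times:
  assumes "a > 0"
  shows "slide_op a (var a * v) = var (Suc a) * slide_op a v"
proof -
  have "slide_op a (var a * Poly_Mapping.single w c) = var (Suc a) * slide_op a (Poly_Mapping.single w c)" for w and c :: 'a
  proof -
    have "var a * Poly_Mapping.single w c = Poly_Mapping.single (Mon (a # letters w)) c"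
      using var_times_single[of a "letters w" c] by simp
    moreover have "var (Suc a) * (const c * Poly_Mapping.single (Mon u) 1) = const c * Poly_Mapping.single (Mon (Suc a # u)) 1" for u
      by (simp add: const_times_single var_times_single)
    ultimately show ?thesis using assms
      by (auto simp add: slide_op_def lin_ext_single)
  qed
  hence "slide_op a (var a * (\<Sum>w\<in>Poly_Mapping.keys v. Poly_Mapping.single w (Poly_Mapping.lookup v w)))
      = var (Suc a) * slide_op a (\<Sum>w\<in>Poly_Mapping.keys v. Poly_Mapping.single w (Poly_Mapping.lookup v w))"
    by (simp add: sum_distrib_left slide_op_linear)
  thus ?thesis by (simp add: sum_single_keys)
qed

text \<open>In the sum the contributions of the intermediate set \<open>A \<union> {i}\<close> cancel.\<close>

lemma twist_sum:
  "twist a (insert i A) j + twist a A i = (twist a (insert j A) i + twist a A j :: 'k::field)"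
  by (simp add: twist_def insert_commute)

lemma twisted_action_add:
  assumes "A \<subseteq> {1..n}" "i \<in> {1..n} - A" "j \<in> {1..n} - A" "i \<noteq> j"
  shows "twisted_action a (insert i A, j) v + twisted_action a (A, i) v
    = twisted_action a (insert j A, i) v + twisted_action a (A, j) v"
proof -
  have fin: "finite A" using assms finite_subset by blast
  have "const (twist a (insert i A) j) * slide_op a v + const (twist a A i) * slide_op a v
     = const (twist a (insert j A) i) * slide_op a v + const (twist a A j) * slide_op a v"
    by (metis twist_sum const_add distrib_right)
  thus ?thesis using assms fin
    by (simp add: twisted_action_def add_ac)
qed

text \<open>The right-hand side is symmetric in \<open>i\<close> and \<open>j\<close>.  If the intermediate set \<open>A \<union> {i}\<close> is \<open>{1..a}\<close>, its two
  contributions \<open>x\<^sub>a\<^sub>+\<^sub>1 H\<close> and \<open>- H x\<^sub>a\<close> cancel by the commutation rule, and otherwise it contributes nothing.\<close>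

lemma twisted_action_mult_aux:
  assumes "a > 0" "A \<subseteq> {1..n}" "i \<in> {1..n} - A" "j \<in> {1..n} - A" "i \<noteq> j"
  defines "B \<equiv> insert j (insert i A)"
  shows "twisted_action a (insert i A, j) (twisted_action a (A, i) v)
    = var (Suc (Suc (card A))) * (var (Suc (card A)) * v)
      - const (of_bool (A = {1..a})) * (var (Suc (Suc (card A))) * slide_op a v)
      + const (of_bool (B = {1..a})) * slide_op a (var (Suc (card A)) * v)"
proof -
  have fin: "finite A" using assms finite_subset by blast
  let ?y1 = "var (Suc (card A)) :: nat free_mon \<Rightarrow>\<^sub>0 'a" and ?y2 = "var (Suc (Suc (card A))) :: nat free_mon \<Rightarrow>\<^sub>0 'a"
  have c: "card (insert i A) = Suc (card A)" using assms fin by simp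
  have comm: "var l * (const c * q) = const c * (var l * q)" for l c and q :: "nat free_mon \<Rightarrow>\<^sub>0 'a"
    by (simp add: const_comm[of c] mult.assoc)
  have "twisted_action a (insert i A, j) (twisted_action a (A, i) v)
     = ?y2 * (?y1 * v) + (const (twist a A i) * (?y2 * slide_op a v) + const (twist a (insert i A) j) * slide_op a (?y1 * v))"
    by (simp add: twisted_action_def c slide_op_linear slide_op_slide_op distrib_left comm add.assoc)
  also have "const (twist a A i) * (?y2 * slide_op a v) + const (twist a (insert i A) j) * slide_op a (?y1 * v)
     = - const (of_bool (A = {1..a})) * (?y2 * slide_op a v) + const (of_bool (B = {1..a})) * slide_op a (?y1 * v)"
  proof (cases "insert i A = {1..a}")
    case True
    hence "Suc (card A) = a" using c by simp
    hence sw: "slide_op a (?y1 * v) = ?y2 * slide_op a v" using slide_op_var_times[OF assms(1), of v] by simp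
    have "j \<notin> insert i A" "i \<in> insert i A" "i \<notin> A" "j \<in> B" using assms by auto
    hence "A \<noteq> {1..a}" "B \<noteq> {1..a}" using True by auto
    thus ?thesis using True by (simp add: twist_def sw B_def const_uminus)
  next
    case False
    thus ?thesis by (simp add: twist_def B_def const_uminus)
  qed
  finally show ?thesis by (simp add: add.assoc)
qed

lemma twisted_action_mult:
  assumes "a > 0" "A \<subseteq> {1..n}" "i \<in> {1..n} - A" "j \<in> {1..n} - A" "i \<noteq> j"
  shows "twisted_action a (insert i A, j) (twisted_action a (A, i) v)
    = twisted_action a (insert j A, i) (twisted_action a (A, j) v)"
  using twisted_action_mult_aux[OF assms, of v]
    twisted_action_mult_aux[OF assms(1,2,4,3) not_sym[OF assms(5)], of v]
  by (simp add: insert_commute)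

section \<open>Leading words of elements in two chain subalgebras\<close>

text \<open>The marked part of what the word does to the empty word under the standard chain
  \<open>\<emptyset>, {1}, {1, 2}, \<dots>\<close> (see \<open>foldr_twisted_action\<close>).  It is a derivation: each letter \<open>x\<^sub>a\<close> in turn is replaced
  by \<open>H\<close>, each letter \<open>x\<^sub>a\<^sub>+\<^sub>1\<close> by \<open>- H\<close>, and \<open>H\<close> is then moved to the right.\<close>

fun deriv_word :: "nat \<Rightarrow> nat list \<Rightarrow> (nat free_mon \<Rightarrow>\<^sub>0 'k::field)" where
  "deriv_word a [] = 0"
| "deriv_word a (l # w) = var l * deriv_word a w
     + Poly_Mapping.single (Mon (slide a w)) (of_bool (l = a) - of_bool (l = Suc a))"

lemma coef_deriv_word_nonzero:
  "coef (deriv_word a w :: nat free_mon \<Rightarrow>\<^sub>0 'k::field) x \<noteq> 0 \<Longrightarrow> length x = length w \<and> 0 \<in> set x"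
proof (induction w arbitrary: x)
  case Nil
  thus ?case by simp
next
  case (Cons l w)
  then consider "coef (var l * deriv_word a w :: nat free_mon \<Rightarrow>\<^sub>0 'k) x \<noteq> 0" | "x = slide a w"
    by (auto simp: lookup_add lookup_single when_def split: if_splits)
  thus ?case
  proof cases
    case 1
    thus ?thesis using Cons.IH by (cases x) (auto simp: lookup_var_times_Nil lookup_var_times_Cons split: if_splits)
  next
    case 2
    thus ?thesis by (simp add: length_slide zero_in_slide)
  qed
qed

lemma foldr_twisted_action:
  assumes "0 \<notin> set w"
  shows "foldr (\<lambda>m. twisted_action a ({1..<m}, m)) w 1
    = (Poly_Mapping.single (Mon w) 1 + deriv_word a w :: nat free_mon \<Rightarrow>\<^sub>0 'k::field)"
  using assms
proof (induction w)
  case Nil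
  show ?case by (simp flip: zero_free_mon_def)
next
  case (Cons l w)
  have "slide_op a (deriv_word a w :: nat free_mon \<Rightarrow>\<^sub>0 'k) = 0"
  proof (rule slide_op_marked)
    fix u assume "u \<in> Poly_Mapping.keys (deriv_word a w :: nat free_mon \<Rightarrow>\<^sub>0 'k)"
    thus "0 \<in> set (letters u)" using coef_deriv_word_nonzero[of a w "letters u"] by (auto simp: in_keys_iff)
  qed
  moreover have "slide_op a (Poly_Mapping.single (Mon w) 1 :: nat free_mon \<Rightarrow>\<^sub>0 'k) = Poly_Mapping.single (Mon (slide a w)) 1"
    using Cons.prems by (simp add: slide_op_def lin_ext_single)
  moreover have "twist a {1..<l} l = (of_bool (l = a) - of_bool (l = Suc a) :: 'k)"
  proof -
    have "insert l {1..<l} = {1..l}" using Cons.prems by auto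
    moreover have "{1..l} = {1..a} \<longleftrightarrow> l = a"
      by (metis card_atLeastAtMost diff_Suc_1)
    moreover have "{1..<l} = {1..a} \<longleftrightarrow> l = Suc a"
    proof (cases l)
      case (Suc m)
      have "{1..m} = {1..a} \<longleftrightarrow> m = a" by (metis card_atLeastAtMost diff_Suc_1)
      thus ?thesis by (simp add: Suc atLeastLessThanSuc_atLeastAtMost)
    qed (use Cons.prems in simp)
    ultimately show ?thesis by (simp add: twist_def)
  qed
  ultimately show ?case using Cons
    by (simp add: twisted_action_def slide_op_linear distrib_left var_times_single const_times_single add.assoc)
qed


text \<open>If a letter \<open>a\<close> of a word is not preceded by \<open>a + 1\<close>, hitting that letter yields a marked word that
  no smaller word yields.  Write \<open>v1\<close> as \<open>a\<^sup>k w\<close> with \<open>w\<close> not starting with \<open>a\<close>; the marked word is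
  \<open>v0 (a+1)\<^sup>k 0 w\<close>.  Since \<open>v0\<close> does not end in \<open>a + 1\<close>, only words \<open>v0 (a+1)\<^sup>k\<^sup>-\<^sup>m l a\<^sup>m w\<close> with \<open>l\<close> equal to \<open>a\<close>
  or \<open>a + 1\<close> yield it, and the smallest of these is \<open>v0 a a\<^sup>k w\<close>.\<close>

lemma deriv_word_extract:
  assumes "0 < a" "0 \<notin> set v0" "v0 = [] \<or> last v0 \<noteq> Suc a" "0 \<notin> set u"
    "coef (deriv_word a u :: nat free_mon \<Rightarrow>\<^sub>0 'k::field) (v0 @ slide a v1) \<noteq> 0"
  shows "v0 @ a # v1 \<le> u"
  using assms(2-)
proof (induction u arbitrary: v0 v1)
  case Nil
  thus ?case by simp
next
  case (Cons l u)
  have len: "length u = length v0 + length v1"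
    using coef_deriv_word_nonzero[OF Cons.prems(4)] by (simp add: length_slide)
  from Cons.prems(4) consider
      (1) "coef (var l * deriv_word a u :: nat free_mon \<Rightarrow>\<^sub>0 'k) (v0 @ slide a v1) \<noteq> 0"
    | (2) "l = a \<or> l = Suc a" "v0 @ slide a v1 = slide a u"
    by (cases "l = a \<or> l = Suc a") (auto simp: lookup_add lookup_single when_def split: if_splits)
  thus ?case
  proof cases
    case 1
    show ?thesis
    proof (cases v0)
      case Nil
      hence "v1 \<noteq> [] \<and> hd v1 = a \<and> l = Suc a"
        using 1 Cons.prems(3) by (cases v1) (auto simp: lookup_var_times_Cons split: if_splits)
      thus ?thesis using len Nil by (auto simp: Cons_le_Cons)
    next
      case v0: (Cons m v0')
      have "l = m" "coef (deriv_word a u :: nat free_mon \<Rightarrow>\<^sub>0 'k) (v0' @ slide a v1) \<noteq> 0"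
        using 1 v0 by (auto simp: lookup_var_times_Cons split: if_splits)
      moreover from this have "v0' @ a # v1 \<le> u"
        using Cons.prems v0 by (intro Cons.IH) auto
      ultimately show ?thesis using len by (simp add: v0 Cons_le_Cons)
    qed
  next
    case 2
    have "set v0 \<subseteq> {Suc a}" using slide_prefix[OF 2(2)[symmetric] Cons.prems(1)] .
    hence "v0 = []" using Cons.prems(2) by (metis last_in_set singletonD subsetD)
    moreover from this have "v1 = u" using slide_inject[of a v1 u] 2(2) by simp
    ultimately show ?thesis using 2(1) by (auto simp: Cons_le_Cons)
  qed
qed

lemma deriv_word_extract_self:
  assumes "0 < a" "0 \<notin> set v0" "v0 = [] \<or> last v0 \<noteq> Suc a"
  shows "coef (deriv_word a (v0 @ a # v1)) (v0 @ slide a v1) = (1 :: 'k::field)"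
  using assms(2-)
proof (induction v0)
  case Nil
  have "coef (var a * deriv_word a v1 :: nat free_mon \<Rightarrow>\<^sub>0 'k) (slide a v1) = 0"
    using assms(1) by (cases v1) (auto simp: lookup_var_times_Cons)
  thus ?case by (simp add: lookup_add)
next
  case (Cons m v0)
  have "slide a (v0 @ a # v1) \<noteq> m # v0 @ slide a v1"
  proof
    assume "slide a (v0 @ a # v1) = m # v0 @ slide a v1"
    hence "set (m # v0) \<subseteq> {Suc a}" using Cons.prems by (intro slide_prefix[of a _ "m # v0" "slide a v1"]) auto
    thus False using Cons.prems(2) last_in_set[of "m # v0"] by blast
  qed
  thus ?case using Cons
    by (auto simp: lookup_add lookup_var_times_Cons lookup_single when_def split: if_splits)
qed

text \<open>Generators along the chain of subsets that \<open>\<tau>\<close> defines; \<open>y n \<tau> m\<close> is the class of \<open>chain \<tau> m\<close>.\<close>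

definition chain :: "(nat \<Rightarrow> nat) \<Rightarrow> nat \<Rightarrow> gen" where
  "chain \<tau> m = (\<tau> ` {1..<m}, \<tau> m)"

lemma chain_gens:
  assumes "\<tau> permutes {1..n}"
  shows "chain \<tau> ` {1..n} \<subseteq> gens n"
proof -
  have "chain \<tau> m \<in> gens n" if "m \<in> {1..n}" for m
  proof -
    have "({1..<m}, m) \<in> gens n" using that by (auto simp: gens_def)
    hence "gen_map \<tau> ({1..<m}, m) \<in> gens n" using gen_map_gens[OF assms] by blast
    thus ?thesis by (simp add: chain_def)
  qed
  thus ?thesis by blast
qed

text \<open>The chain of the transposition avoids \<open>{1..a}\<close>, so it never meets the operator \<open>H\<close>.\<close>

lemma transpose_image_initial: "a > 0 \<Longrightarrow> transpose a (Suc a) ` {1..k} \<noteq> {1..a}"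
proof
  assume a: "a > 0" and eq: "transpose a (Suc a) ` {1..k} = {1..a}"
  have "card (transpose a (Suc a) ` {1..k}) = k" by (simp add: card_image)
  hence "k = a" using eq by simp
  hence "transpose a (Suc a) a \<in> {1..a}" using a eq by (metis atLeastAtMost_iff imageI One_nat_def Suc_leI order_refl)
  thus False by simp
qed

lemma twisted_action_transpose:
  assumes "a > 0" "m > 0"
  shows "twisted_action a (chain (transpose a (Suc a)) m) v = var m * v"
proof -
  let ?s = "transpose a (Suc a)"
  obtain k where k: "m = Suc k" using assms(2) by (cases m) auto
  have "insert m {1..<m} = {1..m}" "{1..<m} = {1..k}" using k by auto
  hence "insert (?s m) (?s ` {1..<m}) = ?s ` {1..m}" "{1..<m} = {1..k}" by (metis image_insert)+
  hence "twist a (?s ` {1..<m}) (?s m) = (0 :: 'a)"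
    using transpose_image_initial[OF assms(1), of m] transpose_image_initial[OF assms(1), of k]
    by (simp add: twist_def)
  moreover have "card (?s ` {1..<m}) = m - 1" by (simp add: card_image)
  ultimately show ?thesis using assms(2) by (simp add: twisted_action_def chain_def)
qed

text \<open>Apply both expressions of the same element of \<open>Q\<^sub>n\<close> to the empty word.  The one along the chain of the transposition
  gives \<open>g\<close>, which is unmarked.  If some letter \<open>a\<close> of the leading word of \<open>f\<close> did not follow \<open>a + 1\<close>, the
  other one would contain a marked word with the leading coefficient of \<open>f\<close>.\<close>

lemma leading_word_descends:
  fixes f g :: "nat free_mon \<Rightarrow>\<^sub>0 'k::field"
  assumes f: "f \<in> carrier (free_algebra {1..n})" and g: "g \<in> carrier (free_algebra {1..n})"
    and a: "0 < a" "a < n"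
    and eq: "quot n (free_map (chain id) f) = quot n (free_map (chain (transpose a (Suc a))) g)"
    and lead: "coef f (v0 @ a # v1) \<noteq> 0" "\<And>u. u \<in> Poly_Mapping.keys f \<Longrightarrow> letters u \<le> v0 @ a # v1"
  shows "v0 \<noteq> [] \<and> last v0 = Suc a"
proof (rule ccontr)
  assume "\<not> ?thesis"
  hence last: "v0 = [] \<or> last v0 \<noteq> Suc a" by blast
  let ?s = "transpose a (Suc a)" and ?x = "v0 @ slide a v1" and ?T = "twisted_action a :: gen \<Rightarrow> _ \<Rightarrow> nat free_mon \<Rightarrow>\<^sub>0 'k"
  have s: "?s permutes {1..n}" using a by (intro permutes_swap_id) auto
  have pos: "0 \<notin> set (letters u)" if "u \<in> Poly_Mapping.keys f \<or> u \<in> Poly_Mapping.keys g" for u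
    using f g that by (fastforce simp: free_algebra_def)
  have v0: "0 \<notin> set v0" using pos[of "Mon (v0 @ a # v1)"] lead(1) by (simp add: in_keys_iff)
  have "op_ext ?T (free_map (chain id) f) 1 = op_ext ?T (free_map (chain ?s) g) 1"
    by (rule op_ext_quot_cong[where n = n])
      (use free_map_closed[OF f chain_gens[OF permutes_id]] free_map_closed[OF g chain_gens[OF s]] eq a
       in \<open>auto simp: linear_op_twisted_action intro!: twisted_action_add[where n = n] twisted_action_mult[where n = n]\<close>)
  moreover have "op_ext ?T (free_map (chain ?s) g) 1 = g"
  proof -
    have "foldr (\<lambda>m. ?T (chain ?s m)) w 1 = Poly_Mapping.single (Mon w) 1" if "0 \<notin> set w" for w
      using that
      by (induction w) (simp_all add: twisted_action_transpose[OF a(1)] var_times_single flip: zero_free_mon_def)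
    thus ?thesis
      unfolding op_ext_free_map unfolding op_ext_def lin_ext_def
      by (simp add: pos const_times_single sum_single_keys)
  qed
  moreover have "coef g ?x = 0"
    using pos[of "Mon ?x"] zero_in_slide by (auto simp: in_keys_iff)
  moreover have "coef (op_ext ?T (free_map (chain id) f) 1) ?x = coef f (v0 @ a # v1)"
  proof -
    have "coef (op_ext ?T (free_map (chain id) f) 1) ?x
       = (\<Sum>u\<in>Poly_Mapping.keys f. Poly_Mapping.lookup f u * coef (foldr (\<lambda>m. ?T ({1..<m}, m)) (letters u) 1) ?x)"
      unfolding op_ext_free_map unfolding op_ext_def lookup_lin_ext by (simp add: chain_def)
    also have "\<dots> = (\<Sum>u\<in>Poly_Mapping.keys f. if u = Mon (v0 @ a # v1) then coef f (v0 @ a # v1) else 0)"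
    proof (rule sum.cong)
      fix u assume u: "u \<in> Poly_Mapping.keys f"
      have "u \<noteq> Mon ?x" using pos[of u] u zero_in_slide[of a v1] by auto
      hence "coef (foldr (\<lambda>m. ?T ({1..<m}, m)) (letters u) 1) ?x = coef (deriv_word a (letters u)) ?x"
        using pos[of u] u by (simp add: foldr_twisted_action lookup_add lookup_single when_def del: One_nat_def)
      also have "\<dots> = (if u = Mon (v0 @ a # v1) then 1 else 0)"
      proof (cases "u = Mon (v0 @ a # v1)")
        case True
        thus ?thesis using deriv_word_extract_self[OF a(1) v0 last] by simp
      next
        case False
        hence "\<not> v0 @ a # v1 \<le> letters u" using lead(2)[OF u] by (metis antisym free_mon.collapse)
        thus ?thesis using deriv_word_extract[OF a(1) v0 last pos, of u] u False by auto
      qed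
      finally show "Poly_Mapping.lookup f u * coef (foldr (\<lambda>m. ?T ({1..<m}, m)) (letters u) 1) ?x
         = (if u = Mon (v0 @ a # v1) then coef f (v0 @ a # v1) else 0)" by simp
    qed simp
    also have "\<dots> = coef f (v0 @ a # v1)" by (simp add: in_keys_iff)
    finally show ?thesis .
  qed
  ultimately show False using lead(1) by simp
qed


section \<open>Leading words of products of coefficients\<close>

lemma length_le_of_lenlex: "(u :: nat list) \<le> v \<Longrightarrow> length u \<le> length v"
  by (auto simp: list_le_def list_less_def dest: lenlex_length)

lemma lenlex_append_mono:
  assumes "(u :: nat list) \<le> v" "t \<le> w"
  shows "u @ t \<le> v @ w"
proof (cases "length t = length w \<and> length u = length v")
  case True
  have "u @ t \<le> v @ t"
    using assms(1) lenlex_append1[of u v _ t t] True by (auto simp: list_le_def list_less_def)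
  moreover have "v @ t \<le> v @ w"
    using assms(2) by (auto simp: list_le_def list_less_def irrefl_def)
  ultimately show ?thesis by (rule order_trans)
next
  case False
  hence "length (u @ t) < length (v @ w)"
    using length_le_of_lenlex[OF assms(1)] length_le_of_lenlex[OF assms(2)] by auto
  thus ?thesis by (simp add: list_le_def list_less_def lenlex_conv)
qed

definition has_lead :: "(nat free_mon \<Rightarrow>\<^sub>0 'k::field) \<Rightarrow> nat list \<Rightarrow> 'k \<Rightarrow> bool" where
  "has_lead p w c \<longleftrightarrow> coef p w = c \<and> (\<forall>u\<in>Poly_Mapping.keys p. letters u \<le> w)"

text \<open>Shorter words are smaller, so two factors bounded by \<open>v\<close> and \<open>w\<close> can concatenate to \<open>v @ w\<close> only if
  they have the lengths of \<open>v\<close> and \<open>w\<close>, that is, only as \<open>v\<close> and \<open>w\<close> themselves.\<close>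

lemma has_lead_mult:
  assumes "has_lead p v c" "has_lead q w d"
  shows "has_lead (p * q) (v @ w) (c * d)"
  unfolding has_lead_def
proof
  show "\<forall>u\<in>Poly_Mapping.keys (p * q). letters u \<le> v @ w"
  proof
    fix u assume "u \<in> Poly_Mapping.keys (p * q)"
    then obtain s t where "u = s + t" "s \<in> Poly_Mapping.keys p" "t \<in> Poly_Mapping.keys q"
      using subsetD[OF keys_mult] by blast
    thus "letters u \<le> v @ w" using assms
      by (simp add: has_lead_def plus_free_mon_def lenlex_append_mono)
  qed
  have "p * q = (\<Sum>s\<in>Poly_Mapping.keys p. \<Sum>t\<in>Poly_Mapping.keys q.
      Poly_Mapping.single (s + t) (Poly_Mapping.lookup p s * Poly_Mapping.lookup q t))"
    by (subst (1) sum_single_keys[of p, symmetric], subst (1) sum_single_keys[of q, symmetric])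
      (simp add: sum_product mult_single)
  hence "coef (p * q) (v @ w) = (\<Sum>s\<in>Poly_Mapping.keys p. \<Sum>t\<in>Poly_Mapping.keys q.
      if s + t = Mon (v @ w) then Poly_Mapping.lookup p s * Poly_Mapping.lookup q t else 0)"
    by (simp add: lookup_sum lookup_single when_def)
  also have "\<dots> = (\<Sum>s\<in>Poly_Mapping.keys p. \<Sum>t\<in>Poly_Mapping.keys q.
      if s = Mon v then (if t = Mon w then c * d else 0) else 0)"
  proof (intro sum.cong refl)
    fix s t assume "s \<in> Poly_Mapping.keys p" "t \<in> Poly_Mapping.keys q"
    hence "length (letters s) \<le> length v" "length (letters t) \<le> length w"
      using assms by (auto simp: has_lead_def length_le_of_lenlex)
    moreover have "length (letters s) + length (letters t) = length v + length w" if "s + t = Mon (v @ w)"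
      using that by (metis free_mon.inject length_append plus_free_mon_def)
    ultimately have "s + t = Mon (v @ w) \<longleftrightarrow> s = Mon v \<and> t = Mon w"
      by (cases s; cases t) (auto simp: plus_free_mon_def append_eq_append_conv)
    thus "(if s + t = Mon (v @ w) then Poly_Mapping.lookup p s * Poly_Mapping.lookup q t else 0)
       = (if s = Mon v then (if t = Mon w then c * d else 0) else 0)"
      using assms by (auto simp: has_lead_def)
  qed
  also have "\<dots> = (\<Sum>s\<in>Poly_Mapping.keys p. if s = Mon v then
      (\<Sum>t\<in>Poly_Mapping.keys q. if t = Mon w then c * d else 0) else 0)"
    by (intro sum.cong) auto
  also have "\<dots> = c * d"
    using assms by (auto simp: has_lead_def in_keys_iff)
  finally show "coef (p * q) (v @ w) = c * d" .
qed

text \<open>The coefficient of \<open>t\<^sup>i\<close> in \<open>(t - x\<^sub>m) \<cdots> (t - x\<^sub>1)\<close>: up to sign, the noncommutative elementary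
  symmetric function of degree \<open>m - i\<close>.\<close>

fun generic_coeff :: "nat \<Rightarrow> nat \<Rightarrow> (nat free_mon \<Rightarrow>\<^sub>0 'k::field)" where
  "generic_coeff 0 i = of_bool (i = 0)"
| "generic_coeff (Suc m) i
    = (case i of 0 \<Rightarrow> 0 | Suc j \<Rightarrow> generic_coeff m j) - var (Suc m) * generic_coeff m i"

lemma generic_coeff_closed: "generic_coeff m i \<in> carrier (free_algebra {1..m})"
proof (induction m arbitrary: i)
  case 0
  show ?case by (auto simp: free_algebra_def zero_free_mon_def)
next
  case (Suc m)
  have IH: "generic_coeff m i \<in> (carrier (free_algebra {1..Suc m}) :: (nat free_mon \<Rightarrow>\<^sub>0 'a) set)" for i
    using Suc free_algebra_mono[of "{1..m}" "{1..Suc m}"] by auto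
  moreover have "(0 :: nat free_mon \<Rightarrow>\<^sub>0 'a) \<in> carrier (free_algebra {1..Suc m})"
    by (simp add: free_algebra_def)
  ultimately show ?case
    unfolding generic_coeff.simps
    by (intro free_closed var_closed) (auto split: nat.split)
qed

lemma generic_coeff_eq_0: "m < i \<Longrightarrow> generic_coeff m i = 0"
  by (induction m arbitrary: i) (auto split: nat.split)

text \<open>The words of this coefficient are the strictly decreasing words of length \<open>m - i\<close>, the largest being
  \<open>m, m - 1, \<dots>, i + 1\<close>.\<close>

lemma has_lead_generic_coeff:
  "i \<le> m \<Longrightarrow> has_lead (generic_coeff m i :: nat free_mon \<Rightarrow>\<^sub>0 'k::field) (rev [Suc i..<Suc m]) ((-1) ^ (m - i))"
proof (induction m arbitrary: i)
  case 0
  thus ?case by (simp add: has_lead_def flip: zero_free_mon_def)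
      (simp add: zero_free_mon_def)
next
  case (Suc m)
  let ?c = "generic_coeff m :: nat \<Rightarrow> nat free_mon \<Rightarrow>\<^sub>0 'k"
  show ?case
  proof (cases "i = Suc m")
    case True
    thus ?thesis using Suc.IH[of m] by (simp add: generic_coeff_eq_0)
  next
    case False
    let ?w = "rev [Suc i..<Suc m]" and ?q = "case i of 0 \<Rightarrow> 0 | Suc j \<Rightarrow> ?c j"
    have i: "i \<le> m" using False Suc.prems by simp
    have w: "rev [Suc i..<Suc (Suc m)] = Suc m # ?w" using i by simp
    have qw: "letters u < Suc m # ?w" if "u \<in> Poly_Mapping.keys ?q" for u
    proof (cases i)
      case (Suc j)
      hence "letters u \<le> rev [Suc j..<Suc m]"
        using Suc.IH[of j] i that by (simp add: has_lead_def)
      also have "rev [Suc j..<Suc m] = m # rev [i..<m]" using i Suc by simp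
      also have "\<dots> < Suc m # ?w" using i by (auto simp: Cons_less_Cons)
      finally show ?thesis .
    qed (use that in simp)
    hence "coef ?q (Suc m # ?w) = 0" by (metis free_mon.sel in_keys_iff less_irrefl)
    moreover have "coef (?c i) ?w = (-1) ^ (m - i)" "\<And>u. u \<in> Poly_Mapping.keys (?c i) \<Longrightarrow> letters u \<le> ?w"
      using Suc.IH[OF i] by (auto simp: has_lead_def)
    moreover have "letters u \<le> Suc m # ?w" if "u \<in> Poly_Mapping.keys (generic_coeff (Suc m) i :: nat free_mon \<Rightarrow>\<^sub>0 'k)" for u
    proof -
      have "u \<in> Poly_Mapping.keys ?q \<or> u \<in> Poly_Mapping.keys (var (Suc m) * ?c i)"
        using that by (auto simp: in_keys_iff lookup_minus)
      thus ?thesis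
      proof
        assume "u \<in> Poly_Mapping.keys (var (Suc m) * ?c i)"
        then obtain u' where "u' \<in> Poly_Mapping.keys (?c i)" "u = Mon ([Suc m] @ letters u')"
          using keys_var_times by fastforce
        thus ?thesis using calculation(3) lenlex_append_mono[of "[Suc m]" "[Suc m]"] by simp
      qed (use qw in \<open>blast intro: less_imp_le\<close>)
    qed
    ultimately show ?thesis unfolding w has_lead_def
      using i by (simp add: lookup_minus lookup_var_times_Cons Suc_diff_le)
  qed
qed

text \<open>The parameter \<open>p\<close> stands in for a letter before the word, so that the condition passes to suffixes.\<close>

fun descends :: "nat \<Rightarrow> nat \<Rightarrow> nat list \<Rightarrow> bool" where
  "descends n p [] \<longleftrightarrow> True"
| "descends n p (i # w) \<longleftrightarrow> (i = n \<or> p = Suc i) \<and> descends n i w"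

lemma descendsI:
  assumes "\<And>w0 i w1. w = w0 @ i # w1 \<Longrightarrow> i \<noteq> n \<Longrightarrow> last (p # w0) = Suc i"
  shows "descends n p w"
  using assms
proof (induction w arbitrary: p)
  case (Cons i w)
  have "i = n \<or> p = Suc i" using Cons.prems[of "[]" i w] by auto
  moreover have "descends n i w"
    using Cons.prems[of "i # _"] by (intro Cons.IH) auto
  ultimately show ?case by simp
qed simp

text \<open>Such words split into runs \<open>n, n - 1, \<dots>, m + 1\<close>, each the leading word of a coefficient.  For the
  induction the run that has been read so far is kept in front: the next letter either prolongs it or is \<open>n\<close>, and then the
  coefficient for the finished run is split off as a factor.\<close>

lemma exists_with_lead:
  fixes K :: "(nat free_mon \<Rightarrow>\<^sub>0 'k::field) set"
  assumes K: "\<And>i. generic_coeff n i \<in> K" "\<And>p q. p \<in> K \<Longrightarrow> q \<in> K \<Longrightarrow> p * q \<in> K"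
    and "1 \<le> n" "m \<le> n" "set w \<subseteq> {1..n}" "descends n (Suc m) w"
  shows "\<exists>p\<in>K. \<exists>c\<noteq>0. has_lead p (rev [Suc m..<Suc n] @ w) c"
  using assms(4-)
proof (induction w arbitrary: m)
  case Nil
  show ?case using K(1)[of m] has_lead_generic_coeff[OF Nil(1)]
    by (intro bexI exI[of _ "(-1) ^ (n - m)"]) auto
next
  case (Cons i w)
  show ?case
  proof (cases "i = m")
    case True
    then obtain k where m: "m = Suc k" using Cons.prems(2) by (cases m) auto
    have "rev [Suc k..<Suc n] = rev [Suc m..<Suc n] @ [m]"
      using Cons.prems(1) m by (simp add: upt_conv_Cons del: upt_Suc)
    thus ?thesis using Cons.IH[of k] Cons.prems True m by simp
  next
    case False
    hence i: "i = n" using Cons.prems(3) by auto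
    obtain k where n: "n = Suc k" using assms(3) by (cases n) auto
    obtain p c where "p \<in> K" "c \<noteq> 0" "has_lead p (rev [n..<Suc n] @ w) c"
      using Cons.IH[of k] Cons.prems i n by auto
    moreover have "has_lead (generic_coeff n m :: nat free_mon \<Rightarrow>\<^sub>0 'k) (rev [Suc m..<Suc n]) ((-1) ^ (n - m))"
      using Cons.prems(1) by (rule has_lead_generic_coeff)
    ultimately have "has_lead (generic_coeff n m * p) (rev [Suc m..<Suc n] @ n # w) ((-1) ^ (n - m) * c)"
      "generic_coeff n m * p \<in> K" "(-1) ^ (n - m) * c \<noteq> 0"
      using has_lead_mult K by fastforce+
    thus ?thesis unfolding i by blast
  qed
qed


section \<open>The subalgebras \<open>Q\<^sub>n\<^sub>,\<^sub>\<tau>\<close> as images of a free algebra\<close>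

lemma quot_minus:
  assumes "p \<in> carrier (free_algebra (gens n))" "q \<in> carrier (free_algebra (gens n))"
  shows "quot n (p - q) = quot n p \<ominus>\<^bsub>Q n\<^esub> quot n q"
proof -
  interpret ring "Q n" by (rule ring_Q)
  have "quot n p = quot n (p - q) \<oplus>\<^bsub>Q n\<^esub> quot n q"
    using quot_add[OF free_closed(3)[OF assms] assms(2)] by simp
  moreover have "quot n p \<in> carrier (Q n)" "quot n q \<in> carrier (Q n)" "quot n (p - q) \<in> carrier (Q n)"
    using assms by (auto intro: quot_closed free_closed)
  ultimately show ?thesis by (simp add: a_minus_def a_assoc r_neg)
qed

lemma quot_0: "quot n 0 = (\<zero>\<^bsub>Q n\<^esub> :: 'k::field Q_elt)"
  and quot_1: "quot n 1 = (\<one>\<^bsub>Q n\<^esub> :: 'k Q_elt)"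
proof -
  interpret ring "Q n :: 'k Q_elt ring" by (rule ring_Q)
  have 0: "(0 :: 'k free_elt) \<in> carrier (free_algebra (gens n))" by (simp add: free_algebra_def)
  show "quot n 0 = (\<zero>\<^bsub>Q n\<^esub> :: 'k Q_elt)"
    using quot_minus[OF 0 0] quot_closed[OF 0] by (simp add: a_minus_def r_neg)
  show "quot n 1 = (\<one>\<^bsub>Q n\<^esub> :: 'k Q_elt)" using ring_hom_memE(4)[OF quot_hom, of n] by (simp add: free_algebra_def)
qed

definition chain_eval :: "nat \<Rightarrow> (nat \<Rightarrow> nat) \<Rightarrow> (nat free_mon \<Rightarrow>\<^sub>0 'k::field) \<Rightarrow> 'k Q_elt" where
  "chain_eval n \<tau> f = quot n (free_map (chain \<tau>) f)"

context
  fixes n :: nat and \<tau> :: "nat \<Rightarrow> nat"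
  assumes \<tau>: "\<tau> permutes {1..n}"
begin

lemma chain_map_closed:
  "f \<in> carrier (free_algebra {1..n}) \<Longrightarrow> free_map (chain \<tau>) f \<in> carrier (free_algebra (gens n))"
  by (rule free_map_closed[OF _ chain_gens[OF \<tau>]])

lemma chain_eval_closed: "f \<in> carrier (free_algebra {1..n}) \<Longrightarrow> chain_eval n \<tau> f \<in> carrier (Q n)"
  unfolding chain_eval_def by (intro quot_closed chain_map_closed)

lemma chain_eval_add:
  "f \<in> carrier (free_algebra {1..n}) \<Longrightarrow> g \<in> carrier (free_algebra {1..n})
    \<Longrightarrow> chain_eval n \<tau> (f + g) = chain_eval n \<tau> f \<oplus>\<^bsub>Q n\<^esub> chain_eval n \<tau> g"
  by (simp add: chain_eval_def free_map_add quot_add chain_map_closed)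

lemma chain_eval_mult:
  "f \<in> carrier (free_algebra {1..n}) \<Longrightarrow> g \<in> carrier (free_algebra {1..n})
    \<Longrightarrow> chain_eval n \<tau> (f * g) = chain_eval n \<tau> f \<otimes>\<^bsub>Q n\<^esub> chain_eval n \<tau> g"
  by (simp add: chain_eval_def free_map_mult quot_mult chain_map_closed)

lemma chain_eval_minus:
  "f \<in> carrier (free_algebra {1..n}) \<Longrightarrow> g \<in> carrier (free_algebra {1..n})
    \<Longrightarrow> chain_eval n \<tau> (f - g) = chain_eval n \<tau> f \<ominus>\<^bsub>Q n\<^esub> chain_eval n \<tau> g"
  by (simp add: chain_eval_def free_map_diff quot_minus chain_map_closed)

lemma chain_eval_const: "chain_eval n \<tau> (const c) = quot n (const c)"
  by (simp add: chain_eval_def free_map_const)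

lemma chain_eval_var: "chain_eval n \<tau> (var m) = y n \<tau> m"
  by (simp add: chain_eval_def free_map_var chain_def y_def z_def)

lemma act_chain_eval:
  "\<sigma> permutes {1..n} \<Longrightarrow> act \<sigma> (chain_eval n \<tau> f) = chain_eval n (\<sigma> \<circ> \<tau>) f"
proof -
  have "gen_map \<sigma> \<circ> chain \<tau> = chain (\<sigma> \<circ> \<tau>)"
    by (auto simp: chain_def fun_eq_iff)
  thus "\<sigma> permutes {1..n} \<Longrightarrow> act \<sigma> (chain_eval n \<tau> f) = chain_eval n (\<sigma> \<circ> \<tau>) f"
    by (simp add: chain_eval_def act_quot free_map_comp)
qed

end

lemma unital_subalgebraD:
  assumes "unital_subalgebra n V"
  shows "a \<in> V \<Longrightarrow> b \<in> V \<Longrightarrow> a \<oplus>\<^bsub>Q n\<^esub> b \<in> V" "a \<in> V \<Longrightarrow> b \<in> V \<Longrightarrow> a \<otimes>\<^bsub>Q n\<^esub> b \<in> V"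
    "a \<in> V \<Longrightarrow> b \<in> V \<Longrightarrow> a \<ominus>\<^bsub>Q n\<^esub> b \<in> V" "quot n (const c) \<in> V"
  using assms subringE[of V "Q n"] by (auto simp: unital_subalgebra_def a_minus_def)

text \<open>Closure under negation follows, as negation is multiplication by the scalar \<open>-1\<close>.\<close>

lemma unital_subalgebraI:
  fixes V :: "'k::field Q_elt set"
  assumes sub: "V \<subseteq> carrier (Q n)"
    and const: "\<And>c. quot n (const c) \<in> V"
    and add: "\<And>a b. a \<in> V \<Longrightarrow> b \<in> V \<Longrightarrow> a \<oplus>\<^bsub>Q n\<^esub> b \<in> V"
    and mult: "\<And>a b. a \<in> V \<Longrightarrow> b \<in> V \<Longrightarrow> a \<otimes>\<^bsub>Q n\<^esub> b \<in> V"
  shows "unital_subalgebra n V"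
proof -
  interpret ring "Q n :: 'k Q_elt ring" by (rule ring_Q)
  have "\<one>\<^bsub>Q n\<^esub> \<in> V" using const[of 1] by (simp add: quot_1)
  moreover have "\<ominus>\<^bsub>Q n\<^esub> a \<in> V" if "a \<in> V" for a
  proof -
    have "0 \<in> (carrier (free_algebra (gens n)) :: 'k free_elt set)" by (simp add: free_algebra_def)
    hence "quot n (const (- 1)) = (\<zero>\<^bsub>Q n\<^esub> \<ominus>\<^bsub>Q n\<^esub> \<one>\<^bsub>Q n\<^esub> :: 'k Q_elt)"
      using quot_minus[of "0 :: 'k free_elt" n "const 1"] const_closed[of "1 :: 'k" "gens n"]
      by (simp add: quot_0 quot_1 const_uminus)
    hence "quot n (const (- 1)) \<otimes>\<^bsub>Q n\<^esub> a = \<ominus>\<^bsub>Q n\<^esub> a"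
      using that sub by (auto simp: a_minus_def l_minus)
    thus ?thesis using mult[OF const[of "- 1"] that] by simp
  qed
  ultimately have "subring V (Q n)" using sub add mult by (intro subringI) auto
  thus ?thesis using const by (simp add: unital_subalgebra_def)
qed

lemma unital_subalgebra_chain_eval:
  assumes \<tau>: "\<tau> permutes {1..n}"
  shows "unital_subalgebra n (chain_eval n \<tau> ` carrier (free_algebra {1..n}))"
proof (rule unital_subalgebraI)
  show "quot n (const c) \<in> chain_eval n \<tau> ` carrier (free_algebra {1..n})" for c
    by (rule image_eqI[of _ _ "const c"]) (simp_all add: chain_eval_const[OF \<tau>] const_closed)
qed (auto simp: chain_eval_closed[OF \<tau>] free_closed
      simp flip: chain_eval_add[OF \<tau>] chain_eval_mult[OF \<tau>])

lemma chain_eval_in_subalgebra: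
  assumes \<tau>: "\<tau> permutes {1..n}" and V: "unital_subalgebra n V"
    and gen: "\<And>m. m \<in> {1..n} \<Longrightarrow> y n \<tau> m \<in> V" and f: "f \<in> carrier (free_algebra {1..n})"
  shows "chain_eval n \<tau> f \<in> V"
  using f by (induction rule: free_algebra_induct)
    (simp_all add: chain_eval_const[OF \<tau>] chain_eval_var[OF \<tau>] chain_eval_add[OF \<tau>] chain_eval_mult[OF \<tau>]
      unital_subalgebraD[OF V] gen)

lemma r_Suc:
  assumes \<tau>: "\<tau> permutes {1..n}" and m: "m < n"
  shows "r n (\<tau> ` {1..Suc m}) = (y n \<tau> (Suc m) \<oplus>\<^bsub>Q n\<^esub> r n (\<tau> ` {1..m}) :: 'k::field Q_elt)"
proof -
  interpret ring "Q n :: 'k Q_elt ring" by (rule ring_Q)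
  have r: "r n (\<tau> ` {1..k}) = (\<Oplus>\<^bsub>Q n\<^esub>i\<in>{..<k}. y n \<tau> (Suc i) :: 'k Q_elt)"
    and cl: "(\<lambda>i. y n \<tau> (Suc i) :: 'k Q_elt) \<in> {..<k} \<rightarrow> carrier (Q n)" if "k \<le> n" for k
  proof -
    let ?l = "map \<tau> [1..<Suc k]"
    have l: "distinct ?l" "set ?l = \<tau> ` {1..k}" "length ?l = k"
      using permutes_inj[OF \<tau>]
      by (auto simp: distinct_map atLeastLessThanSuc_atLeastAtMost simp del: upt_Suc intro: inj_on_subset)
    have sub: "set ?l \<subseteq> {1..n}"
      using that permutes_image[OF \<tau>] unfolding l(2) by (metis atLeastatMost_subset_iff image_mono order_refl)
    have nth: "z n (set (take i ?l)) (?l ! i) = (y n \<tau> (Suc i) :: 'k Q_elt)" if "i < k" for i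
      using that by (auto simp: y_def take_map simp del: upt_Suc)
    show cl: "(\<lambda>i. y n \<tau> (Suc i) :: 'k Q_elt) \<in> {..<k} \<rightarrow> carrier (Q n)"
    proof
      fix i assume i: "i \<in> {..<k}"
      have "z n (set (take i ?l)) (?l ! i) \<in> (carrier (Q n) :: 'k Q_elt set)"
        by (rule funcset_mem[OF r_list_closed[OF l(1) sub order.refl]]) (use i l(3) in simp)
      thus "(y n \<tau> (Suc i) :: 'k Q_elt) \<in> carrier (Q n)" using nth i by (simp del: upt_Suc)
    qed
    show "r n (\<tau> ` {1..k}) = (\<Oplus>\<^bsub>Q n\<^esub>i\<in>{..<k}. y n \<tau> (Suc i) :: 'k Q_elt)"
      unfolding l(2)[symmetric] r_eq_r_list[OF l(1) sub] r_list_def l(3)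
      by (rule finsum_cong'[OF refl cl]) (use nth in simp)
  qed
  have "(\<lambda>i. y n \<tau> (Suc i) :: 'k Q_elt) \<in> {..<m} \<rightarrow> carrier (Q n)" "(y n \<tau> (Suc m) :: 'k Q_elt) \<in> carrier (Q n)"
    using cl[of "Suc m"] cl[of m] m by (auto simp: Pi_iff)
  thus ?thesis
    unfolding r[OF Suc_leI[OF m]] r[OF less_imp_le[OF m]] by (simp add: lessThan_Suc)
qed

lemma r_empty: "r n {} = \<zero>\<^bsub>Q n\<^esub>"
proof -
  interpret ring "Q n" by (rule ring_Q)
  show ?thesis by (simp add: r_def r_list_def)
qed

text \<open>By \<open>r_Suc\<close>, the generators \<open>r\<close> of \<open>Q\<^sub>n\<^sub>,\<^sub>\<tau>\<close> are the partial sums of the \<open>y\<^sub>m\<^sub>,\<^sub>\<tau>\<close>, so both families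
  generate the same subalgebra.\<close>

lemma Q_perm_eq:
  assumes \<tau>: "\<tau> permutes {1..n}"
  shows "Q_perm n \<tau> = (chain_eval n \<tau> ` carrier (free_algebra {1..n}) :: 'k::field Q_elt set)"
proof
  interpret ring "Q n :: 'k Q_elt ring" by (rule ring_Q)
  let ?I = "chain_eval n \<tau> ` carrier (free_algebra {1..n}) :: 'k Q_elt set"
  have I: "unital_subalgebra n ?I" by (rule unital_subalgebra_chain_eval[OF \<tau>])
  have y: "y n \<tau> m \<in> ?I" if "m \<in> {1..n}" for m
    using that by (intro image_eqI[of _ _ "var m"]) (simp_all add: chain_eval_var[OF \<tau>] var_closed)
  have rI: "r n (\<tau> ` {1..m}) \<in> ?I" if "m \<le> n" for m
    using that
  proof (induction m)
    case 0
    show ?case using unital_subalgebraD(4)[OF I, of 0] by (simp add: r_empty quot_0)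
  next
    case (Suc m)
    have "r n (\<tau> ` {1..Suc m}) = (y n \<tau> (Suc m) \<oplus>\<^bsub>Q n\<^esub> r n (\<tau> ` {1..m}) :: 'k Q_elt)"
      using Suc.prems by (intro r_Suc[OF \<tau>]) simp
    thus ?case using unital_subalgebraD(1)[OF I y[of "Suc m"]] Suc by simp
  qed
  show "Q_perm n \<tau> \<subseteq> ?I"
    unfolding Q_perm_def alg_gen_def by (rule hull_minimal) (use rI I in auto)
  show "?I \<subseteq> Q_perm n \<tau>"
    unfolding Q_perm_def alg_gen_def hull_def
  proof (intro subsetI InterI)
    fix w and V :: "'k Q_elt set" assume w: "w \<in> ?I" and "V \<in> {t. unital_subalgebra n t \<and> {r n (\<tau> ` {1..m}) |m. m \<in> {1..n}} \<subseteq> t}"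
    hence V: "unital_subalgebra n V" and r: "r n (\<tau> ` {1..m}) \<in> V" if "m \<in> {1..n}" for m
      using that by auto
    have "y n \<tau> m \<in> V" if m: "m \<in> {1..n}" for m
    proof -
      obtain k where k: "m = Suc k" "k < n" using m by (cases m) auto
      have rk: "r n (\<tau> ` {1..k}) \<in> V"
      proof (cases k)
        case 0
        thus ?thesis using unital_subalgebraD(4)[OF V, of m 0] m by (simp add: r_empty quot_0)
      qed (use r k in simp)
      have "y n \<tau> m \<in> (carrier (Q n) :: 'k Q_elt set)" "r n (\<tau> ` {1..k}) \<in> (carrier (Q n) :: 'k Q_elt set)"
        using y[OF m] rI[of k] k chain_eval_closed[OF \<tau>] by auto
      moreover have "r n (\<tau> ` {1..m}) = (y n \<tau> m \<oplus>\<^bsub>Q n\<^esub> r n (\<tau> ` {1..k}) :: 'k Q_elt)"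
        unfolding k(1) by (rule r_Suc[OF \<tau> k(2)])
      ultimately have "y n \<tau> m = r n (\<tau> ` {1..m}) \<ominus>\<^bsub>Q n\<^esub> (r n (\<tau> ` {1..k}) :: 'k Q_elt)"
        by (simp add: a_minus_def a_assoc r_neg)
      thus ?thesis using unital_subalgebraD(3)[OF V[OF m] r[OF m] rk] by simp
    qed
    moreover have "unital_subalgebra n V" using \<open>V \<in> _\<close> by blast
    ultimately show "w \<in> V" using w chain_eval_in_subalgebra[OF \<tau>] by blast
  qed
qed

section \<open>The coefficients of \<open>P(t)\<close>\<close>

lemma coeff_lin_factor_mult:
  assumes a: "a \<in> (carrier (Q n) :: 'k::field Q_elt set)" and p: "p \<in> carrier (UP (Q n))"
  shows "coeff (UP (Q n)) (lin_factor n a \<otimes>\<^bsub>UP (Q n)\<^esub> p) i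
    = (case i of 0 \<Rightarrow> \<zero>\<^bsub>Q n\<^esub> | Suc j \<Rightarrow> coeff (UP (Q n)) p j) \<ominus>\<^bsub>Q n\<^esub> a \<otimes>\<^bsub>Q n\<^esub> coeff (UP (Q n)) p i"
proof -
  interpret UP_ring "Q n" "UP (Q n) :: ('k Q_elt, nat \<Rightarrow> 'k Q_elt) up_ring"
    by (intro UP_ring.intro ring_Q)
  let ?X = "monom (UP (Q n)) \<one>\<^bsub>Q n\<^esub> 1 :: nat \<Rightarrow> 'k Q_elt" and ?C = "monom (UP (Q n)) a 0"
  have "lin_factor n a \<otimes>\<^bsub>UP (Q n)\<^esub> p = ?X \<otimes>\<^bsub>UP (Q n)\<^esub> p \<ominus>\<^bsub>UP (Q n)\<^esub> ?C \<otimes>\<^bsub>UP (Q n)\<^esub> p"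
    using a p by (simp add: lin_factor_def a_minus_def P.l_distr P.l_minus)
  moreover have "coeff (UP (Q n)) (?X \<otimes>\<^bsub>UP (Q n)\<^esub> p) i = (case i of 0 \<Rightarrow> \<zero>\<^bsub>Q n\<^esub> | Suc j \<Rightarrow> coeff (UP (Q n)) p j)"
  proof (cases i)
    case 0
    thus ?thesis using p by simp
  next
    case (Suc j)
    thus ?thesis using coeff_monom_mult[of "\<one>\<^bsub>Q n\<^esub>" p 1 j] p by simp
  qed
  moreover have "coeff (UP (Q n)) (?C \<otimes>\<^bsub>UP (Q n)\<^esub> p) i = a \<otimes>\<^bsub>Q n\<^esub> coeff (UP (Q n)) p i"
    using coeff_monom_mult[of a p 0 i] a p by simp
  moreover have "?X \<otimes>\<^bsub>UP (Q n)\<^esub> p \<in> carrier (UP (Q n))" "?C \<otimes>\<^bsub>UP (Q n)\<^esub> p \<in> carrier (UP (Q n))"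
    using a p by auto
  ultimately show ?thesis by simp
qed

lemma coeff_P:
  assumes \<tau>: "\<tau> permutes {1..n}"
  shows "coeff (UP (Q n)) (P n \<tau>) i = (chain_eval n \<tau> (generic_coeff n i) :: 'k::field Q_elt)"
proof -
  interpret UP_ring "Q n" "UP (Q n) :: ('k Q_elt, nat \<Rightarrow> 'k Q_elt) up_ring"
    by (intro UP_ring.intro ring_Q)
  have "coeff (UP (Q n)) (P_list n (map \<tau> [1..<Suc m])) i = (chain_eval n \<tau> (generic_coeff m i) :: 'k Q_elt)"
    if "m \<le> n" for m
    using that
  proof (induction m arbitrary: i)
    case 0
    show ?case
      using free_map_const[of "chain \<tau>" "1 :: 'k"]
      by (simp add: P_list_def chain_eval_def free_map_0 quot_0 quot_1)
  next
    case (Suc m)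
    let ?g = "generic_coeff m :: nat \<Rightarrow> nat free_mon \<Rightarrow>\<^sub>0 'k" and ?l = "map \<tau> [1..<Suc m]"
    have g: "?g j \<in> carrier (free_algebra {1..n})" for j
      using generic_coeff_closed[of m j] free_algebra_mono[of "{1..m}" "{1..n}"] Suc.prems by auto
    have zero: "(0 :: nat free_mon \<Rightarrow>\<^sub>0 'k) \<in> carrier (free_algebra {1..n})" by (simp add: free_algebra_def)
    have l: "distinct ?l" "set ?l = \<tau> ` {1..m}"
      using permutes_inj[OF \<tau>]
      by (auto simp: distinct_map atLeastLessThanSuc_atLeastAtMost simp del: upt_Suc intro: inj_on_subset)
    have "set ?l \<subseteq> {1..n}"
      using Suc.prems permutes_image[OF \<tau>] unfolding l(2)
      by (metis Suc_leD atLeastatMost_subset_iff image_mono order_refl)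
    hence pl: "P_list n ?l \<in> (carrier (UP (Q n)) :: (nat \<Rightarrow> 'k Q_elt) set)"
      using l(1) by (intro P_list_closed)
    have "z n (set ?l) (\<tau> (Suc m)) = chain_eval n \<tau> (var (Suc m))"
      unfolding l(2) chain_eval_var[OF \<tau>] y_def by (simp add: atLeastLessThanSuc_atLeastAtMost)
    moreover have v: "var (Suc m) \<in> (carrier (free_algebra {1..n}) :: (nat free_mon \<Rightarrow>\<^sub>0 'k) set)"
      using Suc.prems by (intro var_closed) auto
    ultimately have zl: "z n (set ?l) (\<tau> (Suc m)) = (chain_eval n \<tau> (var (Suc m)) :: 'k Q_elt)"
      "(chain_eval n \<tau> (var (Suc m)) :: 'k Q_elt) \<in> carrier (Q n)"
      by (auto intro: chain_eval_closed[OF \<tau>])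
    have "map \<tau> [1..<Suc (Suc m)] = ?l @ [\<tau> (Suc m)]" by simp
    hence "coeff (UP (Q n)) (P_list n (map \<tau> [1..<Suc (Suc m)])) i
      = (case i of 0 \<Rightarrow> \<zero>\<^bsub>Q n\<^esub> | Suc j \<Rightarrow> chain_eval n \<tau> (?g j))
        \<ominus>\<^bsub>Q n\<^esub> chain_eval n \<tau> (var (Suc m)) \<otimes>\<^bsub>Q n\<^esub> chain_eval n \<tau> (?g i)"
      using Suc.IH Suc.prems zl pl
      by (simp add: P_list_snoc coeff_lin_factor_mult del: upt_Suc cong: nat.case_cong)
    also have "\<dots> = chain_eval n \<tau> (generic_coeff (Suc m) i)"
    proof -
      have "(case i of 0 \<Rightarrow> \<zero>\<^bsub>Q n\<^esub> | Suc j \<Rightarrow> chain_eval n \<tau> (?g j))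
         = chain_eval n \<tau> (case i of 0 \<Rightarrow> 0 | Suc j \<Rightarrow> ?g j)"
        by (auto split: nat.split simp: chain_eval_def free_map_0 quot_0)
      moreover have "(case i of 0 \<Rightarrow> 0 | Suc j \<Rightarrow> ?g j) \<in> carrier (free_algebra {1..n})"
        using g zero by (auto split: nat.split)
      ultimately show ?thesis using g v
        by (simp add: chain_eval_minus[OF \<tau>] chain_eval_mult[OF \<tau>] free_closed)
    qed
    finally show ?case .
  qed
  from this[of n] show ?thesis unfolding P_eq_P_list by simp
qed


section \<open>The three descriptions coincide\<close>

lemma unital_subalgebra_Q_perm: "\<tau> permutes {1..n} \<Longrightarrow> unital_subalgebra n (Q_perm n \<tau>)"
  by (simp only: Q_perm_eq unital_subalgebra_chain_eval)

text \<open>By induction on a bound \<open>w\<close> for the words of \<open>f\<close>, using the well-founded order.  The set \<open>K\<close> collects the elements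
  of \<open>F\<close> that all the substitutions send to one and the same element of \<open>V\<close>.  It contains the scalars and the
  generic coefficients and is closed under products, so the leading term of \<open>f\<close> can be cancelled by an element of \<open>K\<close>, and
  subtracting that element preserves membership in the intersection.\<close>

lemma intersection_subset:
  fixes V :: "'k::field Q_elt set"
  assumes n: "1 \<le> n" and V: "unital_subalgebra n V" and \<rho>: "\<rho> permutes {1..n}" and coeffs: "P_coeffs n \<rho> \<subseteq> V"
  shows "(\<Inter>\<tau>\<in>{\<tau>. \<tau> permutes {1..n}}. Q_perm n \<tau>) \<subseteq> V"
proof -
  let ?F = "carrier (free_algebra {1..n}) :: (nat free_mon \<Rightarrow>\<^sub>0 'k) set"
  let ?I = "\<Inter>\<tau>\<in>{\<tau>. \<tau> permutes {1..n}}. Q_perm n \<tau> :: 'k Q_elt set"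
  define K where "K = {f \<in> ?F. \<exists>v\<in>V. \<forall>\<tau>. \<tau> permutes {1..n} \<longrightarrow> chain_eval n \<tau> f = v}"
  have id: "id permutes {1..n}" by (rule permutes_id)
  have K_coeff: "generic_coeff n i \<in> K" for i
  proof -
    have indep: "chain_eval n \<tau> (generic_coeff n i) = (chain_eval n \<sigma> (generic_coeff n i) :: 'k Q_elt)"
      if "\<tau> permutes {1..n}" "\<sigma> permutes {1..n}" for \<tau> \<sigma>
      using arg_cong[OF P_indep[OF that], of "\<lambda>p. coeff (UP (Q n)) p i"]
      unfolding coeff_P[OF that(1)] coeff_P[OF that(2)] .
    have "chain_eval n \<rho> (generic_coeff n i) \<in> V"
      using coeffs unfolding P_coeffs_def coeff_P[OF \<rho>, symmetric] by blast
    thus ?thesis unfolding K_def using generic_coeff_closed indep[OF _ \<rho>] by blast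
  qed
  have K_mult: "p * q \<in> K" if pq: "p \<in> K" "q \<in> K" for p q
  proof -
    obtain v w where vw: "v \<in> V" "w \<in> V" "\<And>\<tau>. \<tau> permutes {1..n} \<Longrightarrow> chain_eval n \<tau> p = v"
      "\<And>\<tau>. \<tau> permutes {1..n} \<Longrightarrow> chain_eval n \<tau> q = w"
      using pq unfolding K_def by blast
    moreover have "p \<in> ?F" "q \<in> ?F" using pq by (auto simp: K_def)
    ultimately show ?thesis
      unfolding K_def using unital_subalgebraD(2)[OF V vw(1,2)]
      by (auto simp: free_closed chain_eval_mult)
  qed
  have K_const: "const c \<in> K" for c
    using unital_subalgebraD(4)[OF V] by (auto simp: K_def const_closed chain_eval_const)
  have K_V: "chain_eval n id f \<in> V" if "f \<in> K" for f
    using that id by (auto simp: K_def)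
  have KI: "chain_eval n id f \<in> ?I" if f: "f \<in> K" for f
  proof
    fix \<tau> assume "\<tau> \<in> {\<tau>. \<tau> permutes {1..n}}"
    hence \<tau>: "\<tau> permutes {1..n}" by simp
    have "chain_eval n id f = chain_eval n \<tau> f" using f id \<tau> by (auto simp: K_def)
    thus "chain_eval n id f \<in> Q_perm n \<tau>" using f by (simp add: Q_perm_eq[OF \<tau>] K_def)
  qed
  have I: "a \<ominus>\<^bsub>Q n\<^esub> b \<in> ?I" if ab: "a \<in> ?I" "b \<in> ?I" for a b
  proof
    fix \<tau> assume "\<tau> \<in> {\<tau>. \<tau> permutes {1..n}}"
    hence \<tau>: "\<tau> permutes {1..n}" by simp
    show "a \<ominus>\<^bsub>Q n\<^esub> b \<in> Q_perm n \<tau>"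
      using ab \<tau> by (intro unital_subalgebraD(3)[OF unital_subalgebra_Q_perm]) auto
  qed
  have main: "chain_eval n id f \<in> V"
    if "f \<in> ?F" "chain_eval n id f \<in> ?I" "\<And>u. u \<in> Poly_Mapping.keys f \<Longrightarrow> letters u \<le> w" for f w
    using that
  proof (induction w arbitrary: f rule: less_induct)
    case (less w f)
    show ?case
    proof (cases "Poly_Mapping.keys f = {}")
      case True
      hence "f = const 0" by simp
      thus ?thesis by (simp only: K_V K_const)
    next
      case False
      define v where "v = Max (letters ` Poly_Mapping.keys f)"
      have v: "v \<in> letters ` Poly_Mapping.keys f" unfolding v_def using False by (intro Max_in) auto
      have v_max: "letters u \<le> v" if "u \<in> Poly_Mapping.keys f" for u
        using that unfolding v_def by simp
      have fv: "coef f v \<noteq> 0" using v by (auto simp: in_keys_iff)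
      have v_set: "set v \<subseteq> {1..n}" using v less.prems(1) by (auto simp: free_algebra_def)
      \<comment> \<open>The fictitious predecessor \<open>n + 1\<close> forces the first letter to be \<open>n\<close>.\<close>
      have "descends n (Suc n) v"
      proof (rule descendsI)
        fix v0 a v1 assume dec: "v = v0 @ a # v1" and "a \<noteq> n"
        hence a: "0 < a" "a < n" using v_set by auto
        have "transpose a (Suc a) permutes {1..n}" using a by (intro permutes_swap_id) auto
        hence "chain_eval n id f \<in> Q_perm n (transpose a (Suc a))" using less.prems(2) by blast
        then obtain g where g: "g \<in> ?F" "chain_eval n id f = chain_eval n (transpose a (Suc a)) g"
          using \<open>transpose a (Suc a) permutes {1..n}\<close> by (auto simp: Q_perm_eq)
        have "v0 \<noteq> [] \<and> last v0 = Suc a"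
          using g(2) fv v_max unfolding chain_eval_def dec
          by (intro leading_word_descends[OF less.prems(1) g(1) a]) auto
        thus "last (Suc n # v0) = Suc a" by simp
      qed
      then obtain p c where p: "p \<in> K" "c \<noteq> 0" "has_lead p v c"
        using exists_with_lead[of n K n v, OF K_coeff K_mult n order.refl v_set] by auto
      define q where "q = const (coef f v / c) * p"
      have q: "q \<in> K" "q \<in> ?F" using K_mult[OF K_const p(1)] by (auto simp: q_def K_def)
      have q_lead: "coef q v = coef f v" "\<And>u. u \<in> Poly_Mapping.keys q \<Longrightarrow> letters u \<le> v"
        using p by (auto simp: q_def has_lead_def lookup_const_times in_keys_iff)
      let ?h = "f - q"
      have h: "?h \<in> ?F" using less.prems(1) q(2) by (rule free_closed)
      have eval_h: "chain_eval n id ?h = chain_eval n id f \<ominus>\<^bsub>Q n\<^esub> chain_eval n id q"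
        by (rule chain_eval_minus[OF id less.prems(1) q(2)])
      have h_less: "letters u < v" if "u \<in> Poly_Mapping.keys ?h" for u
      proof -
        have "u \<in> Poly_Mapping.keys f \<or> u \<in> Poly_Mapping.keys q"
          using that by (auto simp: in_keys_iff lookup_minus)
        hence "letters u \<le> v" using v_max q_lead(2) by blast
        moreover have "letters u \<noteq> v"
          using that q_lead(1) by (auto simp: in_keys_iff lookup_minus)
        ultimately show ?thesis by simp
      qed
      have "chain_eval n id ?h \<in> V"
      proof (cases "Poly_Mapping.keys ?h = {}")
        case True
        hence "?h = const 0" by simp
        thus ?thesis by (simp only: K_V K_const)
      next
        case False
        let ?w = "Max (letters ` Poly_Mapping.keys ?h)"
        have "?w < v" using False h_less by (subst Max_less_iff) auto
        moreover have "v \<le> w" using v less.prems(3) by auto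
        ultimately have "?w < w" by (rule less_le_trans)
        moreover have "chain_eval n id ?h \<in> ?I"
          unfolding eval_h by (rule I[OF less.prems(2) KI[OF q(1)]])
        moreover have "letters u \<le> ?w" if "u \<in> Poly_Mapping.keys ?h" for u
          using that by simp
        ultimately show ?thesis by (rule less.IH[OF _ h])
      qed
      moreover have "chain_eval n id q \<in> V" using q(1) by (rule K_V)
      ultimately have "chain_eval n id (?h + q) \<in> V"
        unfolding chain_eval_add[OF id h q(2)] by (rule unital_subalgebraD(1)[OF V])
      thus ?thesis unfolding diff_add_cancel .
    qed
  qed
  show ?thesis
  proof
    fix w assume w: "w \<in> ?I"
    hence "w \<in> Q_perm n id" using id by blast
    then obtain f where f: "f \<in> ?F" "w = chain_eval n id f" using Q_perm_eq[OF id, where 'k = 'k] by blast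
    have "letters u \<le> Max (letters ` Poly_Mapping.keys f)" if "u \<in> Poly_Mapping.keys f" for u
      using that by simp
    thus "w \<in> V" using main f w by blast
  qed
qed

lemma unital_subalgebra_S_invariants:
  fixes V :: "'k::field Q_elt set"
  assumes V: "unital_subalgebra n V"
  shows "unital_subalgebra n (S_invariants n V)"
proof (rule unital_subalgebraI)
  have sub: "V \<subseteq> carrier (Q n)" using V subringE(1) by (auto simp: unital_subalgebra_def)
  thus "S_invariants n V \<subseteq> carrier (Q n)" by (auto simp: S_invariants_def)
  show "quot n (const c) \<in> S_invariants n V" for c
    using unital_subalgebraD(4)[OF V] by (simp add: S_invariants_def act_const)
  fix a b assume ab: "a \<in> S_invariants n V" "b \<in> S_invariants n V"
  hence cl: "a \<in> carrier (Q n)" "b \<in> carrier (Q n)" using sub by (auto simp: S_invariants_def)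
  show "a \<oplus>\<^bsub>Q n\<^esub> b \<in> S_invariants n V" "a \<otimes>\<^bsub>Q n\<^esub> b \<in> S_invariants n V"
    using ab unital_subalgebraD(1,2)[OF V] ring_hom_memE(2,3)[OF act_hom cl]
    by (auto simp: S_invariants_def)
qed

text \<open>The permutation \<open>\<tau> \<circ> \<sigma>\<inverse>\<close> fixes the invariant element, and moves its expression along the chain of \<open>\<sigma>\<close> to
  one along the chain of \<open>\<tau>\<close>.\<close>

lemma S_invariants_subset_Q_perm:
  assumes \<sigma>: "\<sigma> permutes {1..n}" and \<tau>: "\<tau> permutes {1..n}"
  shows "S_invariants n (Q_perm n \<sigma>) \<subseteq> (Q_perm n \<tau> :: 'k::field Q_elt set)"
proof
  fix w :: "'k Q_elt" assume w: "w \<in> S_invariants n (Q_perm n \<sigma>)"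
  then obtain f where f: "f \<in> carrier (free_algebra {1..n})" "w = chain_eval n \<sigma> f"
    by (auto simp: S_invariants_def Q_perm_eq[OF \<sigma>])
  have "\<tau> \<circ> inv_into UNIV \<sigma> permutes {1..n}" using permutes_compose[OF permutes_inv[OF \<sigma>] \<tau>] .
  hence "w = chain_eval n (\<tau> \<circ> inv_into UNIV \<sigma> \<circ> \<sigma>) f"
    using w unfolding f(2) by (simp add: S_invariants_def act_chain_eval[OF \<sigma>])
  also have "\<tau> \<circ> inv_into UNIV \<sigma> \<circ> \<sigma> = \<tau>" using permutes_inv_o(2)[OF \<sigma>] by (simp add: comp_assoc)
  finally show "w \<in> Q_perm n \<tau>" using f(1) by (simp add: Q_perm_eq[OF \<tau>])
qed

lemma P_coeffs_invariant:
  assumes \<sigma>: "\<sigma> permutes {1..n}" and \<rho>: "\<rho> permutes {1..n}"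
  shows "P_coeffs n \<rho> \<subseteq> (S_invariants n (Q_perm n \<sigma>) :: 'k::field Q_elt set)"
proof
  fix w :: "'k Q_elt" assume "w \<in> P_coeffs n \<rho>"
  then obtain i where i: "w = coeff (UP (Q n)) (P n \<rho>) i" by (auto simp: P_coeffs_def)
  have w: "w = chain_eval n \<tau> (generic_coeff n i)" if "\<tau> permutes {1..n}" for \<tau>
    unfolding i P_indep[OF \<rho> that] by (rule coeff_P[OF that])
  have "act \<tau> w = w" if "\<tau> permutes {1..n}" for \<tau>
  proof -
    have "act \<tau> w = chain_eval n (\<tau> \<circ> \<sigma>) (generic_coeff n i)"
      unfolding w[OF \<sigma>] by (rule act_chain_eval[OF \<sigma> that])
    thus ?thesis using w[OF permutes_compose[OF \<sigma> that]] by simp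
  qed
  moreover have "w \<in> Q_perm n \<sigma>"
    unfolding Q_perm_eq[OF \<sigma>] using w[OF \<sigma>] generic_coeff_closed by blast
  ultimately show "w \<in> S_invariants n (Q_perm n \<sigma>)" by (simp add: S_invariants_def)
qed

theorem theorem1p5p2:
  fixes n :: nat and \<sigma> \<rho> :: "nat \<Rightarrow> nat"
  assumes "n \<ge> 1" and "\<sigma> permutes {1..n}" and "\<rho> permutes {1..n}"
  shows "(\<Inter>\<tau>\<in>{\<tau>. \<tau> permutes {1..n}}. Q_perm n \<tau>) = (S_invariants n (Q_perm n \<sigma>) :: 'k::field Q_elt set)
       \<and> S_invariants n (Q_perm n \<sigma>) = (alg_gen n (P_coeffs n \<rho>) :: 'k Q_elt set)"
proof -
  let ?I = "\<Inter>\<tau>\<in>{\<tau>. \<tau> permutes {1..n}}. Q_perm n \<tau> :: 'k Q_elt set"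
  have "S_invariants n (Q_perm n \<sigma>) \<subseteq> ?I"
    using S_invariants_subset_Q_perm[OF assms(2)] by blast
  moreover have "?I \<subseteq> alg_gen n (P_coeffs n \<rho>)"
    unfolding alg_gen_def hull_def using intersection_subset[OF assms(1) _ assms(3)] by blast
  moreover have "alg_gen n (P_coeffs n \<rho>) \<subseteq> (S_invariants n (Q_perm n \<sigma>) :: 'k Q_elt set)"
    unfolding alg_gen_def
    by (intro hull_minimal P_coeffs_invariant unital_subalgebra_S_invariants unital_subalgebra_Q_perm assms)
  ultimately show ?thesis by blast
qed

end
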